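(* Let $\mathcal{A}$ be a finite central arrangement in an $\ell$-dimensional Euclidean space $V$, $m:\mathcal{A}\to\mathbb{Z}$ a multiplicity, and define the multiplicity $-m$ on $\mathcal{A}$ by $(-m)(H):=-m(H)$ for $H\in\mathcal{A}$. Let $D\Omega(\mathcal{A},m)$ and $D\Omega(\mathcal{A},-m)$ be the generalized logarithmic modules with respect to a fixed inner product $I^*$ on $V^*$. Then $D\Omega(\mathcal{A},m)$ and $D\Omega(\mathcal{A},-m)$ are $S$-dual modules.
   Context: $V$ is an $\ell$-dimensional real vector space with a fixed inner product $I^*$ on $V^*$; $x_1,\dots,x_\ell$ is a basis of $V^*$; $S=\mathrm{Sym}(V^* )\otimes_{\mathbb{R}}\mathbb{C}\simeq\mathbb{C}[x_1,\dots,x_\ell]$, $\mathrm{Der}_{\mathbb{C}}(S)=\bigoplus_i S\,\partial_{x_i}$, $\Omega^1_V=\bigoplus_i S\,dx_i$; the subscript $(0)$ denotes localization at the ideal $(0)$ (coefficients in the fraction field of $S$). A central arrangement $\mathcal{A}$ is a finite set of linear hyperplanes in $V$; for each $H\in\mathcal{A}$ fix $\alpha_H\in V^*$ with $\ker\alpha_H=H$. For a finite set $\mathcal{B}$ of linear hyperplanes and $n:\mathcal{B}\to\mathbb{Z}_{\ge 0}$, put $Q(\mathcal{B},n)=\prod_{H\in\mathcal{B}}\alpha_H^{n(H)}$ and $$D(\mathcal{B},n)=\{\theta\in\mathrm{Der}_{\mathbb{C}}(S)\mid \theta(\alpha_H)\in S\alpha_H^{n(H)}\ \forall H\in\mathcal{B}\},$$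 $$\Omega^1(\mathcal{B},n)=\{\omega\in \tfrac{1}{Q(\mathcal{B},n)}\Omega^1_V\mid d\alpha_H\wedge\omega \text{ is regular (has no pole) along } H\ \forall H\in\mathcal{B}\}.$$ The inner product induces an $S$-linear isomorphism $I^*:\Omega^1_V\to\mathrm{Der}_{\mathbb{C}}(S)$, $I^*(\omega)(f)=I^*(\omega,df)$ (with $I^*$ extended $S$-bilinearly), and likewise $I^*:(\Omega^1_V)_{(0)}\to \mathrm{Der}_{\mathbb{C}}(S)_{(0)}$. For a multiplicity $m:\mathcal{A}\to\mathbb{Z}$ let $\mathcal{A}_+=\{H: m(H)>0\}$, $\mathcal{A}_-=\{H: m(H)<0\}$, $Q_+=\prod_{H\in\mathcal{A}_+}\alpha_H^{m(H)}$, $Q_-=\prod_{H\in\mathcal{A}_-}\alpha_H^{-m(H)}$, and for $\mu\in\{+,-\}$ let $m_\mu(H)=m(H)$ if $H\in\mathcal{A}_\mu$ and $m_\mu(H)=0$ otherwise. The generalized logarithmic module is the $S$-module $$D\Omega(\mathcal{A},m)=\tfrac{1}{Q_-}D(\mathcal{A}_+,m_+)\cap I^*(\Omega^1(\mathcal{A}_-,-m_-))\subset \mathrm{Der}_{\mathbb{C}}(S)_{(0)}.$$ Two $S$-modules $M,N$ are called $S$-dual if there is an $S$-bilinear pairing $M\times N\to S$ for which the induced maps $M\to\mathrm{Hom}_S(N,S)$ and $N\to\mathrm{Hom}_S(M,S)$ are both isomorphisms. *)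

theory Defs
  imports
    "HOL-Analysis.Finite_Cartesian_Product"
    "HOL-Library.Poly_Mapping"
    "HOL-Library.FuncSet"
    "HOL-Computational_Algebra.Fraction_Field"
begin

section \<open>The ring \<open>S\<close>, its fraction field, derivations and differential forms\<close>

text \<open>
  The index type \<open>'n\<close> plays the role of \<open>{1..l}\<close>. Its linear order has no mathematical
  meaning: it is required by the class instance that makes the polynomial ring an integral domain.
\<close>

type_synonym 'n mpoly = "('n \<Rightarrow>\<^sub>0 nat) \<Rightarrow>\<^sub>0 complex"

type_synonym 'n ratfun = "'n mpoly fract"

definition Const :: "complex \<Rightarrow> 'n mpoly"
  where "Const c = Poly_Mapping.single 0 c"

definition Var :: "'n \<Rightarrow> 'n mpoly"
  where "Var i = Poly_Mapping.single (Poly_Mapping.single i 1) 1"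

definition emb :: "'n::linorder mpoly \<Rightarrow> 'n ratfun"
  where "emb p = Fraction_Field.Fract p 1"

definition pdiff :: "'n \<Rightarrow> 'n mpoly \<Rightarrow> 'n mpoly"
  where "pdiff i p = (\<Sum>u\<in>Poly_Mapping.keys p.
    Poly_Mapping.single (u - Poly_Mapping.single i 1)
      (of_nat (Poly_Mapping.lookup u i) * Poly_Mapping.lookup p u))"

text \<open>
  The modules of derivations and of 1-forms over the fraction field are both free on
  \<open>'n\<close>; an element is given by its coefficients with respect to the \<open>\<partial>/\<partial>x\<^sub>i\<close>, respectively
  the \<open>dx\<^sub>i\<close>. The submodules over \<open>S\<close> itself are the vectors in \<open>regular_vecs\<close>.
\<close>

type_synonym 'n rat_der = "'n ratfun ^ 'n"

type_synonym 'n rat_form = "'n ratfun ^ 'n"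

definition regular_vecs :: "('n::{finite,linorder} ratfun, 'n) vec set"
  where "regular_vecs = {v. \<forall>i. v $ i \<in> range emb}"

text \<open>\<open>der_apply \<theta> f\<close> is \<open>\<theta>(f)\<close>; \<open>ext_d f\<close> is \<open>df\<close>.\<close>

definition der_apply :: "'n::{finite,linorder} rat_der \<Rightarrow> 'n mpoly \<Rightarrow> 'n ratfun"
  where "der_apply \<theta> f = (\<Sum>i\<in>UNIV. \<theta> $ i * emb (pdiff i f))"

definition ext_d :: "'n::{finite,linorder} mpoly \<Rightarrow> 'n rat_form"
  where "ext_d f = (\<chi> i. emb (pdiff i f))"

text \<open>
  A 2-form is given by its antisymmetric coefficient matrix: the \<open>(i,j)\<close> entry
  for \<open>i < j\<close> is the coefficient of \<open>dx\<^sub>i \<and> dx\<^sub>j\<close>.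
\<close>

definition wedge ::
  "'n::{finite,linorder} rat_form \<Rightarrow> 'n rat_form \<Rightarrow> (('n ratfun, 'n) vec, 'n) vec"
  where "wedge \<eta> \<omega> = (\<chi> i j. \<eta> $ i * \<omega> $ j - \<eta> $ j * \<omega> $ i)"

text \<open>
  For \<open>a\<close> the equation of a hyperplane \<open>H\<close>, a rational function has no pole along \<open>H\<close> iff
  it has a denominator that is not divisible by \<open>a\<close> (as \<open>a\<close> is then prime in \<open>S\<close>).
\<close>

definition regular_along :: "'n::linorder mpoly \<Rightarrow> 'n ratfun \<Rightarrow> bool"
  where "regular_along a f \<longleftrightarrow> (\<exists>p q. \<not> a dvd q \<and> f = Fraction_Field.Fract p q)"

definition form2_regular_along ::
  "'n::{finite,linorder} mpoly \<Rightarrow> (('n ratfun, 'n) vec, 'n) vec \<Rightarrow> bool"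
  where "form2_regular_along a \<tau> \<longleftrightarrow> (\<forall>i j. regular_along a (\<tau> $ i $ j))"


section \<open>The dual space and its inner product\<close>

text \<open>Elements of \<open>V\<^sup>*\<close> are the functions \<open>V \<Rightarrow> \<real>\<close> satisfying \<open>linear\<close>.\<close>

definition dual_basis :: "('n::finite \<Rightarrow> 'v::real_vector \<Rightarrow> real) \<Rightarrow> bool"
  where "dual_basis x \<longleftrightarrow> (\<forall>i. linear (x i)) \<and>
    (\<forall>f. linear f \<longrightarrow> (\<exists>!c. f = (\<lambda>v. \<Sum>i\<in>UNIV. c i * x i v)))"

definition dual_coords ::
  "('n::finite \<Rightarrow> 'v::real_vector \<Rightarrow> real) \<Rightarrow> ('v \<Rightarrow> real) \<Rightarrow> 'n \<Rightarrow> real"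
  where "dual_coords x f = (THE c. f = (\<lambda>v. \<Sum>i\<in>UNIV. c i * x i v))"

text \<open>The inclusion of \<open>V\<^sup>*\<close> into \<open>S\<close>.\<close>

definition lin_poly ::
  "('n::finite \<Rightarrow> 'v::real_vector \<Rightarrow> real) \<Rightarrow> ('v \<Rightarrow> real) \<Rightarrow> 'n mpoly"
  where "lin_poly x f = (\<Sum>i\<in>UNIV. Const (complex_of_real (dual_coords x f i)) * Var i)"

definition dual_inner_product ::
  "(('v::real_vector \<Rightarrow> real) \<Rightarrow> ('v \<Rightarrow> real) \<Rightarrow> real) \<Rightarrow> bool"
  where "dual_inner_product I \<longleftrightarrow>
    (\<forall>f g h. linear f \<and> linear g \<and> linear h \<longrightarrow> I (\<lambda>v. f v + g v) h = I f h + I g h) \<and>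
    (\<forall>c f g. linear f \<and> linear g \<longrightarrow> I (\<lambda>v. c * f v) g = c * I f g) \<and>
    (\<forall>f g. linear f \<and> linear g \<longrightarrow> I f g = I g f) \<and>
    (\<forall>f. linear f \<and> f \<noteq> (\<lambda>v. 0) \<longrightarrow> I f f > 0)"

text \<open>The bilinear extension of the inner product to rational 1-forms.\<close>

definition I_form ::
  "('n::{finite,linorder} \<Rightarrow> 'v::real_vector \<Rightarrow> real) \<Rightarrow>
   (('v \<Rightarrow> real) \<Rightarrow> ('v \<Rightarrow> real) \<Rightarrow> real) \<Rightarrow> 'n rat_form \<Rightarrow> 'n rat_form \<Rightarrow> 'n ratfun"
  where "I_form x I \<omega> \<eta> = (\<Sum>i\<in>UNIV. \<Sum>j\<in>UNIV.
    \<omega> $ i * \<eta> $ j * emb (Const (complex_of_real (I (x i) (x j)))))"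

text \<open>
  The derivation \<open>f \<mapsto> I(\<omega>, df)\<close>; its coefficient at \<open>\<partial>/\<partial>x\<^sub>j\<close> is its value at \<open>x\<^sub>j\<close>.
\<close>

definition I_der ::
  "('n::{finite,linorder} \<Rightarrow> 'v::real_vector \<Rightarrow> real) \<Rightarrow>
   (('v \<Rightarrow> real) \<Rightarrow> ('v \<Rightarrow> real) \<Rightarrow> real) \<Rightarrow> 'n rat_form \<Rightarrow> 'n rat_der"
  where "I_der x I \<omega> = (\<chi> j. I_form x I \<omega> (ext_d (Var j)))"

lemma pdiff_Var: "pdiff i (Var j) = (if i = j then 1 else 0)"
  by (auto simp: pdiff_def Var_def lookup_single when_def)

lemma emb_0 [simp]: "emb 0 = 0" and emb_1 [simp]: "emb 1 = 1"
  by (simp_all add: emb_def Zero_fract_def One_fract_def)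

lemma emb_add: "emb (p + q) = emb p + emb q" and emb_mult: "emb (p * q) = emb p * emb q"
  by (simp_all add: emb_def)

lemma ext_d_Var: "ext_d (Var j) = axis j 1"
  by (simp add: vec_eq_iff ext_d_def axis_def pdiff_Var)

lemma der_apply_I_der: "der_apply (I_der x I \<omega>) f = I_form x I \<omega> (ext_d f)"
proof -
  have "I_der x I \<omega> $ j = (\<Sum>i\<in>UNIV. \<omega> $ i * emb (Const (complex_of_real (I (x i) (x j)))))" for j
    by (simp add: I_der_def I_form_def ext_d_Var axis_def if_distrib if_distribR cong: if_cong)
  then have "der_apply (I_der x I \<omega>) f = (\<Sum>j\<in>UNIV. \<Sum>i\<in>UNIV.
      \<omega> $ i * emb (pdiff j f) * emb (Const (complex_of_real (I (x i) (x j)))))"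
    by (simp add: der_apply_def sum_distrib_left sum_distrib_right mult_ac)
  also have "\<dots> = I_form x I \<omega> (ext_d f)"
    unfolding I_form_def ext_d_def by (subst sum.swap) simp
  finally show ?thesis .
qed


section \<open>Arrangements and logarithmic modules\<close>

definition central_arrangement :: "'v::real_vector set set \<Rightarrow> bool"
  where "central_arrangement A \<longleftrightarrow>
    finite A \<and> (\<forall>H\<in>A. subspace H \<and> dim H + 1 = dim (UNIV :: 'v set))"

definition defining_forms :: "'v::real_vector set set \<Rightarrow> ('v set \<Rightarrow> 'v \<Rightarrow> real) \<Rightarrow> bool"
  where "defining_forms A \<alpha> \<longleftrightarrow> (\<forall>H\<in>A. linear (\<alpha> H) \<and> {v. \<alpha> H v = 0} = H)"

definition arr_Q ::
  "('n::{finite,linorder} \<Rightarrow> 'v::real_vector \<Rightarrow> real) \<Rightarrow> ('v set \<Rightarrow> 'v \<Rightarrow> real) \<Rightarrow>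
   'v set set \<Rightarrow> ('v set \<Rightarrow> nat) \<Rightarrow> 'n mpoly"
  where "arr_Q x \<alpha> B n = (\<Prod>H\<in>B. lin_poly x (\<alpha> H) ^ n H)"

definition log_der ::
  "('n::{finite,linorder} \<Rightarrow> 'v::real_vector \<Rightarrow> real) \<Rightarrow> ('v set \<Rightarrow> 'v \<Rightarrow> real) \<Rightarrow>
   'v set set \<Rightarrow> ('v set \<Rightarrow> nat) \<Rightarrow> 'n rat_der set"
  where "log_der x \<alpha> B n = {\<theta> \<in> regular_vecs. \<forall>H\<in>B.
    \<exists>s. der_apply \<theta> (lin_poly x (\<alpha> H)) = emb (s * lin_poly x (\<alpha> H) ^ n H)}"

definition log_form ::
  "('n::{finite,linorder} \<Rightarrow> 'v::real_vector \<Rightarrow> real) \<Rightarrow> ('v set \<Rightarrow> 'v \<Rightarrow> real) \<Rightarrow>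
   'v set set \<Rightarrow> ('v set \<Rightarrow> nat) \<Rightarrow> 'n rat_form set"
  where "log_form x \<alpha> B n =
    {\<omega> \<in> (\<lambda>\<eta>. inverse (emb (arr_Q x \<alpha> B n)) *s \<eta>) ` regular_vecs. \<forall>H\<in>B.
      form2_regular_along (lin_poly x (\<alpha> H)) (wedge (ext_d (lin_poly x (\<alpha> H))) \<omega>)}"

definition pos_part :: "'v set set \<Rightarrow> ('v set \<Rightarrow> int) \<Rightarrow> 'v set set"
  where "pos_part A m = {H \<in> A. m H > 0}"

definition neg_part :: "'v set set \<Rightarrow> ('v set \<Rightarrow> int) \<Rightarrow> 'v set set"
  where "neg_part A m = {H \<in> A. m H < 0}"

text \<open>The multiplicities \<open>m\<^sub>+\<close> and \<open>-m\<^sub>-\<close>, which take values in the natural numbers.\<close>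

definition pos_mult :: "'v set set \<Rightarrow> ('v set \<Rightarrow> int) \<Rightarrow> 'v set \<Rightarrow> nat"
  where "pos_mult A m H = (if H \<in> pos_part A m then nat (m H) else 0)"

definition neg_mult :: "'v set set \<Rightarrow> ('v set \<Rightarrow> int) \<Rightarrow> 'v set \<Rightarrow> nat"
  where "neg_mult A m H = (if H \<in> neg_part A m then nat (- m H) else 0)"

text \<open>The product \<open>Q\<^sub>-\<close> is \<open>arr_Q x \<alpha> (neg_part A m) (neg_mult A m)\<close>.\<close>

definition gen_log_module ::
  "('n::{finite,linorder} \<Rightarrow> 'v::real_vector \<Rightarrow> real) \<Rightarrow>
   (('v \<Rightarrow> real) \<Rightarrow> ('v \<Rightarrow> real) \<Rightarrow> real) \<Rightarrow> ('v set \<Rightarrow> 'v \<Rightarrow> real) \<Rightarrow>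
   'v set set \<Rightarrow> ('v set \<Rightarrow> int) \<Rightarrow> 'n rat_der set"
  where "gen_log_module x I \<alpha> A m =
    (\<lambda>\<theta>. inverse (emb (arr_Q x \<alpha> (neg_part A m) (neg_mult A m))) *s \<theta>) `
      log_der x \<alpha> (pos_part A m) (pos_mult A m) \<inter>
    I_der x I ` log_form x \<alpha> (neg_part A m) (neg_mult A m)"


section \<open>Dual modules\<close>

definition vec_scale ::
  "'n::{finite,linorder} mpoly \<Rightarrow> ('n ratfun, 'n) vec \<Rightarrow> ('n ratfun, 'n) vec"
  where "vec_scale p v = emb p *s v"

lemma module_vec_scale: "module vec_scale"
  by unfold_locales
    (simp_all add: vec_scale_def emb_add emb_mult vec_eq_iff algebra_simps)

text \<open>
  \<open>Hom(N, R)\<close> for a submodule \<open>N\<close> of a module with scalar multiplication \<open>s\<close>; functions on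
  \<open>N\<close> are represented by extensional functions.
\<close>

definition hom_ring :: "('r::comm_ring_1 \<Rightarrow> 'b::ab_group_add \<Rightarrow> 'b) \<Rightarrow> 'b set \<Rightarrow> ('b \<Rightarrow> 'r) set"
  where "hom_ring s N = {f \<in> extensional N.
    (\<forall>y\<in>N. \<forall>z\<in>N. f (y + z) = f y + f z) \<and> (\<forall>c. \<forall>y\<in>N. f (s c y) = c * f y)}"

text \<open>
  That both partial maps of \<open>b\<close> take values in \<open>hom_ring\<close> is bilinearity of \<open>b\<close>, so that the
  two induced maps are linear and being an isomorphism means being bijective.
\<close>

definition dual_modules ::
  "('r::comm_ring_1 \<Rightarrow> 'b::ab_group_add \<Rightarrow> 'b) \<Rightarrow> 'b set \<Rightarrow>
   ('r \<Rightarrow> 'c::ab_group_add \<Rightarrow> 'c) \<Rightarrow> 'c set \<Rightarrow> bool"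
  where "dual_modules s M t N \<longleftrightarrow>
    module s \<and> module.subspace s M \<and> module t \<and> module.subspace t N \<and>
    (\<exists>b. bij_betw (\<lambda>x. restrict (\<lambda>y. b x y) N) M (hom_ring t N) \<and>
         bij_betw (\<lambda>y. restrict (\<lambda>x. b x y) M) N (hom_ring s M))"

end

theory Submission
  imports
    Defs
    "HOL-Analysis.Cartesian_Space"
    "HOL-Computational_Algebra.Factorial_Ring"
begin

text \<open>
  The modules attached to \<open>m\<close> and \<open>-m\<close> are paired by \<open>(\<delta>, \<eta>) \<mapsto> I\<^sup>-\<^sup>1(\<delta>, \<eta>)\<close>. Along a hyperplane
  \<open>H\<close> with \<open>k = m(H) > 0\<close> the two conditions are \<open>\<delta>(\<alpha>\<^sub>H) \<in> \<alpha>\<^sub>H\<^sup>k S\<^sub>H\<close> on a regular \<open>\<delta>\<close>, and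
  \<open>\<eta> \<in> S\<^sub>H\<^sup>l + \<alpha>\<^sub>H\<^sup>-\<^sup>k S\<^sub>H I\<^sup>*(d\<alpha>\<^sub>H)\<close>. Hence the pairing has no pole along any \<open>H\<close>, and as its
  denominator is a product of the primes \<open>\<alpha>\<^sub>H\<close>, its values lie in \<open>S\<close>. Conversely, a functional on one
  module is the pairing with a rational derivation, and its values on multiples of basis vectors, of
  \<open>\<alpha>\<^sub>H\<^sup>-\<^sup>k I\<^sup>*(d\<alpha>\<^sub>H)\<close>, and of constant derivations tangent to \<open>H\<close> being in \<open>S\<close> gives exactly the
  conditions that define the other module.
\<close>

section \<open>Linear forms are prime\<close>

definition subst :: "('n::{finite,linorder} \<Rightarrow> 'n mpoly) \<Rightarrow> 'n mpoly \<Rightarrow> 'n mpoly"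
  where "subst \<sigma> p = (\<Sum>u\<in>Poly_Mapping.keys p.
    Const (Poly_Mapping.lookup p u) * (\<Prod>i\<in>UNIV. \<sigma> i ^ Poly_Mapping.lookup u i))"

lemma Const_0 [simp]: "Const 0 = 0"
  and Const_1 [simp]: "Const 1 = 1"
  and Const_add: "Const (c + d) = Const c + Const d"
  and Const_diff: "Const (c - d) = Const c - Const d"
  and Const_mult: "Const (c * d) = Const c * Const d"
  by (simp_all add: Const_def single_add single_diff mult_single)

lemma poly_mapping_sum_superset:
  assumes "finite K" "Poly_Mapping.keys p \<subseteq> K"
  shows "(\<Sum>u\<in>K. Poly_Mapping.single u (Poly_Mapping.lookup p u)) = p"
proof (rule poly_mapping_eqI)
  fix k
  have "Poly_Mapping.lookup p k = 0" if "k \<notin> K"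
    using that assms(2) by (auto simp: in_keys_iff)
  then show "Poly_Mapping.lookup (\<Sum>u\<in>K. Poly_Mapping.single u (Poly_Mapping.lookup p u)) k
      = Poly_Mapping.lookup p k"
    by (auto simp: lookup_sum lookup_single when_def assms(1))
qed

lemmas poly_mapping_sum_keys = poly_mapping_sum_superset[OF finite_keys subset_refl]

text \<open>Terms outside the support contribute zero, so polynomials with different supports can be
  expanded over one common index set.\<close>

lemma subst_superset:
  assumes "finite K" "Poly_Mapping.keys p \<subseteq> K"
  shows "subst \<sigma> p = (\<Sum>u\<in>K.
    Const (Poly_Mapping.lookup p u) * (\<Prod>i\<in>UNIV. \<sigma> i ^ Poly_Mapping.lookup u i))"
  unfolding subst_def using assms
  by (intro sum.mono_neutral_left) (auto simp: in_keys_iff)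

lemma subst_add: "subst \<sigma> (p + q) = subst \<sigma> p + subst \<sigma> q"
proof -
  define K where "K = Poly_Mapping.keys p \<union> Poly_Mapping.keys q"
  have K: "finite K" "Poly_Mapping.keys p \<subseteq> K" "Poly_Mapping.keys q \<subseteq> K"
      "Poly_Mapping.keys (p + q) \<subseteq> K"
    using keys_add[of p q] by (auto simp: K_def)
  show ?thesis
    by (simp add: subst_superset[OF K(1)] K lookup_add Const_add distrib_right sum.distrib)
qed

lemma subst_0 [simp]: "subst \<sigma> 0 = 0"
  by (simp add: subst_def)

lemma subst_sum: "subst \<sigma> (\<Sum>t\<in>T. f t) = (\<Sum>t\<in>T. subst \<sigma> (f t))"
  by (induction T rule: infinite_finite_induct) (simp_all add: subst_add)

lemma subst_single:
  "subst \<sigma> (Poly_Mapping.single u c) = Const c * (\<Prod>i\<in>UNIV. \<sigma> i ^ Poly_Mapping.lookup u i)"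
  by (subst subst_superset[of "{u}"]) auto

lemma subst_mult: "subst \<sigma> (p * q) = subst \<sigma> p * subst \<sigma> q"
proof -
  have single: "subst \<sigma> (Poly_Mapping.single u c * Poly_Mapping.single v d)
      = subst \<sigma> (Poly_Mapping.single u c) * subst \<sigma> (Poly_Mapping.single v d)" for u v c d
    by (simp add: mult_single subst_single lookup_add power_add prod.distrib Const_mult mult_ac)
  have "subst \<sigma> ((\<Sum>u\<in>Poly_Mapping.keys p. Poly_Mapping.single u (Poly_Mapping.lookup p u)) *
        (\<Sum>v\<in>Poly_Mapping.keys q. Poly_Mapping.single v (Poly_Mapping.lookup q v)))
      = subst \<sigma> (\<Sum>u\<in>Poly_Mapping.keys p. Poly_Mapping.single u (Poly_Mapping.lookup p u)) *
        subst \<sigma> (\<Sum>v\<in>Poly_Mapping.keys q. Poly_Mapping.single v (Poly_Mapping.lookup q v))"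
    by (simp only: sum_product subst_sum single)
  then show ?thesis
    by (simp only: poly_mapping_sum_keys)
qed

lemma subst_Const [simp]: "subst \<sigma> (Const c) = Const c"
  by (simp add: Const_def[of c] subst_single)

lemma subst_Var [simp]: "subst \<sigma> (Var i) = \<sigma> i"
proof -
  have "(\<Prod>j\<in>UNIV. \<sigma> j ^ Poly_Mapping.lookup (Poly_Mapping.single i 1) j)
      = (\<Prod>j\<in>UNIV. if i = j then \<sigma> j else 1)"
    by (intro prod.cong) (auto simp: lookup_single)
  then show ?thesis
    by (simp add: Var_def subst_single)
qed

text \<open>This puts a polynomial itself in the shape of \<open>subst\<close>, so that the two can
  be compared term by term.\<close>

lemma single_conv_Var:
  fixes u :: "'n::{finite,linorder} \<Rightarrow>\<^sub>0 nat"
  shows "Poly_Mapping.single u c = Const c * (\<Prod>i\<in>UNIV. Var i ^ Poly_Mapping.lookup u i)"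
proof -
  have pow: "Var i ^ k = Poly_Mapping.single (Poly_Mapping.single i k) 1" for i :: 'n and k
    by (induction k) (simp_all add: Var_def mult_single flip: single_add)
  have "(\<Prod>i\<in>T. Poly_Mapping.single (f i) (1::complex)) = Poly_Mapping.single (\<Sum>i\<in>T. f i) 1"
    for T :: "'n set" and f :: "'n \<Rightarrow> 'n \<Rightarrow>\<^sub>0 nat"
    by (induction T rule: infinite_finite_induct) (simp_all add: mult_single)
  then show ?thesis
    by (simp add: pow poly_mapping_sum_superset Const_def mult_single)
qed

text \<open>Congruence modulo \<open>d\<close> respects sums and products, so fixing each variable
  modulo \<open>d\<close> suffices.\<close>

lemma subst_cong_dvd:
  assumes "\<And>i. d dvd \<sigma> i - Var i"
  shows "d dvd subst \<sigma> p - p"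
proof -
  have mult: "d dvd r * s - r' * s'" if "d dvd r - r'" "d dvd s - s'" for r s r' s' :: "'a mpoly"
  proof -
    have "r * s - r' * s' = r * (s - s') + (r - r') * s'"
      by (simp add: algebra_simps)
    then show ?thesis using that by simp
  qed
  have pow: "d dvd \<sigma> i ^ k - Var i ^ k" for i k
    by (induction k) (auto intro: mult assms)
  have prod: "d dvd (\<Prod>i\<in>T. \<sigma> i ^ f i) - (\<Prod>i\<in>T. Var i ^ f i)" for T f
    by (induction T rule: infinite_finite_induct) (auto intro: mult pow)
  have "subst \<sigma> p - p = (\<Sum>u\<in>Poly_Mapping.keys p. Const (Poly_Mapping.lookup p u) *
      ((\<Prod>i\<in>UNIV. \<sigma> i ^ Poly_Mapping.lookup u i) - (\<Prod>i\<in>UNIV. Var i ^ Poly_Mapping.lookup u i)))"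
    by (subst (2) poly_mapping_sum_keys[symmetric])
      (simp only: subst_def single_conv_Var right_diff_distrib sum_subtractf)
  then show ?thesis
    using prod by (auto intro!: dvd_sum dvd_mult)
qed

section \<open>Linear forms: coefficients, derivatives, elimination of a variable\<close>

definition linform :: "('n::{finite,linorder} \<Rightarrow> complex) \<Rightarrow> 'n mpoly"
  where "linform c = (\<Sum>i\<in>UNIV. Const (c i) * Var i)"

lemma linform_conv_single:
  "linform c = (\<Sum>i\<in>UNIV. Poly_Mapping.single (Poly_Mapping.single i 1) (c i))"
  by (simp add: linform_def Const_def Var_def mult_single)

lemma lookup_linform [simp]: "Poly_Mapping.lookup (linform c) (Poly_Mapping.single i 1) = c i"
proof -
  have "Poly_Mapping.single j (1::nat) = Poly_Mapping.single i 1 \<longleftrightarrow> j = i" for j :: 'a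
    by (metis lookup_single_eq lookup_single_not_eq zero_neq_one)
  then show ?thesis
    by (simp add: linform_conv_single lookup_sum lookup_single when_def)
qed

lemma linform_eq_0_iff: "linform c = 0 \<longleftrightarrow> (\<forall>i. c i = 0)"
proof
  assume "linform c = 0"
  then show "\<forall>i. c i = 0"
    using lookup_linform[of c] by simp
qed (simp add: linform_def)

lemma linform_diff_mult: "linform d - Const e * linform c = linform (\<lambda>i. d i - e * c i)"
  by (simp add: linform_def sum_distrib_left Const_diff Const_mult left_diff_distrib mult.assoc
      sum_subtractf)

lemma pdiff_linform: "pdiff i (linform c) = Const (c i)"
proof -
  \<comment> \<open>All degree-one monomials are taken, whether or not their coefficients vanish, so
    that the sum can be reindexed by the variables.\<close>
  define K where "K = (\<lambda>j. Poly_Mapping.single j (1::nat)) ` (UNIV :: 'a set)"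
  have inj: "inj (\<lambda>j::'a. Poly_Mapping.single j (1::nat))"
    by (rule injI) (metis lookup_single_eq lookup_single_not_eq zero_neq_one)
  have sub: "Poly_Mapping.keys (linform c) \<subseteq> K"
    using keys_sum[of "\<lambda>i. Poly_Mapping.single (Poly_Mapping.single i 1) (c i)" UNIV]
    by (auto simp: linform_conv_single K_def split: if_splits simp del: One_nat_def)
  have "pdiff i (linform c) = (\<Sum>u\<in>K. Poly_Mapping.single (u - Poly_Mapping.single i 1)
      (of_nat (Poly_Mapping.lookup u i) * Poly_Mapping.lookup (linform c) u))"
    unfolding pdiff_def using sub
    by (intro sum.mono_neutral_left) (auto simp: K_def in_keys_iff)
  also have "\<dots> = (\<Sum>j\<in>UNIV. if j = i then Const (c i) else 0)"
    unfolding K_def sum.reindex[OF inj]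
    by (intro sum.cong) (auto simp: lookup_single Const_def simp del: One_nat_def)
  finally show ?thesis by simp
qed

text \<open>
  Solving \<open>linform c = 0\<close> for the variable \<open>j\<close> is a ring endomorphism whose kernel is the
  ideal generated by \<open>linform c\<close>, and \<open>S\<close> is an integral domain.
\<close>

context
  fixes c :: "'n::{finite,linorder} \<Rightarrow> complex" and j :: 'n
  assumes cj: "c j \<noteq> 0"
begin

definition elim_var :: "'n mpoly \<Rightarrow> 'n mpoly"
  where "elim_var = subst (\<lambda>i. Var i - (if i = j then Const (1 / c j) * linform c else 0))"

lemma elim_var_linform: "elim_var (linform d) = linform (\<lambda>i. d i - d j / c j * c i)"
proof -
  have "elim_var (linform d)
      = (\<Sum>i\<in>UNIV. Const (d i) * (Var i - (if i = j then Const (1 / c j) * linform c else 0)))"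
    by (simp only: linform_def[of d] elim_var_def subst_sum subst_mult subst_Const subst_Var)
  also have "\<dots> = linform d - Const (d j / c j) * linform c"
  proof -
    have "Const (d i) * (if i = j then Const (1 / c j) * linform c else 0)
        = (if i = j then Const (d j / c j) * linform c else 0)" for i
      by (simp add: mult.assoc[symmetric] Const_mult[symmetric])
    then show ?thesis
      by (simp add: right_diff_distrib sum_subtractf linform_def[of d])
  qed
  also have "\<dots> = linform (\<lambda>i. d i - d j / c j * c i)"
    by (rule linform_diff_mult)
  finally show ?thesis .
qed

text \<open>\<open>elim_var\<close> kills \<open>linform c\<close>, hence its multiples; conversely
  \<open>p\<close> is congruent to \<open>elim_var p\<close> modulo
  \<open>linform c\<close>.\<close>

lemma linform_dvd_iff: "linform c dvd p \<longleftrightarrow> elim_var p = 0"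
proof
  have "elim_var (linform c) = 0"
    using cj by (simp add: elim_var_linform linform_eq_0_iff)
  moreover assume "linform c dvd p"
  ultimately show "elim_var p = 0"
    by (auto simp: elim_var_def subst_mult)
next
  assume "elim_var p = 0"
  moreover have "linform c dvd elim_var p - p"
    unfolding elim_var_def by (rule subst_cong_dvd) auto
  ultimately show "linform c dvd p" by simp
qed

lemma prime_elem_linform: "prime_elem (linform c)"
proof (rule prime_elemI)
  show "linform c \<noteq> 0"
    using cj by (auto simp: linform_eq_0_iff)
  have "elim_var 1 = 1"
    using subst_Const[of _ 1] by (simp add: elim_var_def)
  then show "\<not> linform c dvd 1"
    by (simp add: linform_dvd_iff)
  show "linform c dvd p \<or> linform c dvd q" if "linform c dvd p * q" for p q
    using that by (simp add: linform_dvd_iff) (simp add: elim_var_def subst_mult)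
qed

text \<open>\<open>elim_var\<close> maps linear forms to linear forms, so divisibility becomes the
  vanishing of coefficients. This later separates distinct hyperplanes.\<close>

lemma linform_dvd_linform:
  assumes "linform c dvd linform d"
  shows "d i = d j / c j * c i"
proof -
  have "\<forall>i. d i - d j / c j * c i = 0"
    using assms unfolding linform_dvd_iff elim_var_linform linform_eq_0_iff .
  then show ?thesis
    by (metis eq_iff_diff_eq_0)
qed

end

section \<open>Rational functions without a pole along a prime\<close>

lemma emb_eq_iff [simp]: "emb p = emb q \<longleftrightarrow> p = q"
  by (simp add: emb_def eq_fract)

lemma emb_eq_0_iff [simp]: "emb p = 0 \<longleftrightarrow> p = 0"
  using emb_eq_iff[of p 0] by simp

lemma emb_uminus: "emb (- p) = - emb p"
  by (simp add: emb_def)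

lemma range_emb_0 [simp]: "0 \<in> range emb"
  by (metis rangeI emb_0)

lemma range_emb_mult: "f \<in> range emb \<Longrightarrow> g \<in> range emb \<Longrightarrow> f * g \<in> range emb"
  by (auto simp flip: emb_mult)

lemma range_emb_add: "f \<in> range emb \<Longrightarrow> g \<in> range emb \<Longrightarrow> f + g \<in> range emb"
  by (auto simp flip: emb_add)

lemma range_emb_uminus: "f \<in> range emb \<Longrightarrow> - f \<in> range emb"
  by (auto simp flip: emb_uminus)

lemma range_emb_sum: "(\<And>t. t \<in> T \<Longrightarrow> f t \<in> range emb) \<Longrightarrow> (\<Sum>t\<in>T. f t) \<in> range emb"
  by (induction T rule: infinite_finite_induct) (auto intro: range_emb_add)

text \<open>With the elimination rule below, this replaces representatives of fractions by
  multipliers \<open>q\<close> outside the ideal of \<open>a\<close>, which are easier to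
  combine.\<close>

lemma regular_alongI:
  assumes "\<not> a dvd q" "emb q * f \<in> range emb"
  shows "regular_along a f"
proof -
  obtain p where p: "emb q * f = emb p" using assms(2) by auto
  have "q \<noteq> 0" using assms(1) by auto
  then have "emb q * f = emb q * Fraction_Field.Fract p q"
    using p by (simp add: emb_def eq_fract)
  then show ?thesis
    using assms(1) \<open>q \<noteq> 0\<close> by (auto simp: regular_along_def)
qed

lemma regular_alongE:
  assumes "regular_along a f"
  obtains q where "\<not> a dvd q" "emb q * f \<in> range emb"
proof -
  obtain p q where pq: "\<not> a dvd q" "f = Fraction_Field.Fract p q"
    using assms by (auto simp: regular_along_def)
  moreover have "q \<noteq> 0" using pq(1) by auto
  ultimately have "emb q * f = emb p"
    by (simp add: emb_def eq_fract)
  then show ?thesis using that pq(1) by auto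
qed

lemma regular_along_emb:
  assumes "prime_elem a" "f \<in> range emb"
  shows "regular_along a f"
  using assms by (intro regular_alongI[of _ 1]) (auto simp: prime_elem_def)

lemma regular_along_mult:
  assumes "prime_elem a" "regular_along a f" "regular_along a g"
  shows "regular_along a (f * g)"
proof -
  obtain q r where qr: "\<not> a dvd q" "emb q * f \<in> range emb" "\<not> a dvd r" "emb r * g \<in> range emb"
    using assms(2,3) by (elim regular_alongE)
  with range_emb_mult[OF qr(2,4)] show ?thesis
    using assms(1) prime_elem_dvd_mult_iff[of a q r]
    by (intro regular_alongI[of _ "q * r"]) (simp_all add: emb_mult mult_ac)
qed

lemma regular_along_add:
  assumes "prime_elem a" "regular_along a f" "regular_along a g"
  shows "regular_along a (f + g)"
proof -
  obtain q r where qr: "\<not> a dvd q" "emb q * f \<in> range emb" "\<not> a dvd r" "emb r * g \<in> range emb"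
    using assms(2,3) by (elim regular_alongE)
  then have "emb r * (emb q * f) + emb q * (emb r * g) \<in> range emb"
    by (intro range_emb_add[OF range_emb_mult[OF rangeI] range_emb_mult[OF rangeI]])
  with qr show ?thesis
    using assms(1) prime_elem_dvd_mult_iff[of a q r]
    by (intro regular_alongI[of _ "q * r"]) (simp_all add: emb_mult algebra_simps)
qed

lemma regular_along_sum:
  assumes "prime_elem a" "\<And>t. t \<in> T \<Longrightarrow> regular_along a (f t)"
  shows "regular_along a (\<Sum>t\<in>T. f t)"
  using assms(2)
  by (induction T rule: infinite_finite_induct)
    (auto intro: regular_along_add assms(1) regular_along_emb)

text \<open>Write \<open>f\<close> as \<open>s / r\<close> with \<open>r\<close> not divisible by
  \<open>a\<close>, and let \<open>t\<close> be the regular product. Then \<open>a\<close> divides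
  \<open>t * r\<close>, hence \<open>t\<close>, and one factor \<open>a\<close> cancels.\<close>

lemma regular_along_cancel_power:
  assumes "prime_elem a" "regular_along a f" "emb (a ^ k * q) * f \<in> range emb"
  shows "emb q * f \<in> range emb"
  using assms(3)
proof (induction k)
  case (Suc k)
  obtain r where r: "\<not> a dvd r" "emb r * f \<in> range emb"
    using assms(2) by (rule regular_alongE)
  obtain s t where s: "emb r * f = emb s" and t: "emb (a ^ Suc k * q) * f = emb t"
    using r(2) Suc.prems by auto
  have "emb (t * r) = emb (a ^ Suc k * q * s)"
    unfolding emb_mult[of t] emb_mult[of _ s] s[symmetric] t[symmetric] by (simp add: mult_ac)
  then have "t * r = a * (a ^ k * q * s)"
    by (simp add: mult_ac)
  then have "a dvd t"
    using assms(1) r(1) by (metis dvd_triv_left prime_elem_dvd_mult_iff)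
  then obtain t' where "t = a * t'" ..
  then have "emb a * (emb (a ^ k * q) * f) = emb a * emb t'"
    using t by (simp add: emb_mult mult_ac)
  then have "emb (a ^ k * q) * f = emb t'"
    using assms(1) by (simp add: prime_elem_def)
  then show ?case
    by (intro Suc.IH) simp
qed simp

text \<open>The primes of the denominator are cancelled one after the other; those with exponent 0
  do not occur in it, so regularity is demanded only for positive exponents.\<close>

lemma regular_along_cancel_prod:
  assumes "finite T" "\<And>t. t \<in> T \<Longrightarrow> prime_elem (p t)"
    and "\<And>t. t \<in> T \<Longrightarrow> k t > 0 \<Longrightarrow> regular_along (p t) f"
    and "emb (\<Prod>t\<in>T. p t ^ k t) * f \<in> range emb"
  shows "f \<in> range emb"
  using assms
proof (induction T rule: finite_induct)
  case (insert t T)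
  have prod: "emb (p t ^ k t * (\<Prod>t\<in>T. p t ^ k t)) * f \<in> range emb"
    using insert.prems(3) insert.hyps by simp
  have "emb (\<Prod>t\<in>T. p t ^ k t) * f \<in> range emb"
  proof (cases "k t = 0")
    case True
    then show ?thesis using prod by simp
  next
    case False
    then have "regular_along (p t) f"
      by (intro insert.prems(2)) auto
    then show ?thesis
      using regular_along_cancel_power[OF insert.prems(1)[OF insertI1] _ prod] by blast
  qed
  then show ?case
    by (intro insert.IH insert.prems(1,2) insertI2)
qed simp


lemma prime_elem_dvd_prod:
  assumes "prime_elem p" "p dvd (\<Prod>t\<in>T. f t)"
  shows "\<exists>t\<in>T. p dvd f t"
  using assms(2)
proof (induction T rule: infinite_finite_induct)
  case (insert t T)
  then have "p dvd f t \<or> p dvd (\<Prod>t\<in>T. f t)"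
    using prime_elem_dvd_mult_iff[OF assms(1)] by simp
  then show ?case
    using insert.IH by blast
qed (simp_all add: prime_elem_not_unit[OF assms(1)])

section \<open>Duality for families of primes\<close>

definition dot :: "'n::{finite,linorder} rat_der \<Rightarrow> 'n rat_form \<Rightarrow> 'n ratfun"
  where "dot u v = (\<Sum>i\<in>UNIV. u $ i * v $ i)"

lemma dot_commute: "dot u v = dot v u"
  by (simp add: dot_def mult.commute)

lemma dot_add: "dot (u + v) w = dot u w + dot v w"
  by (simp add: dot_def distrib_right sum.distrib)

lemma dot_scale: "dot (c *s u) v = c * dot u v"
  by (simp add: dot_def sum_distrib_left mult.assoc)

lemma dot_add_right: "dot u (v + w) = dot u v + dot u w"
  and dot_scale_right: "dot u (c *s v) = c * dot u v"
  by (simp_all add: dot_commute[of u] dot_add dot_scale)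

lemma dot_diff_right: "dot u (v - w) = dot u v - dot u w"
  by (simp add: dot_def right_diff_distrib sum_subtractf)

lemma dot_axis: "dot u (axis i c) = u $ i * c"
  by (simp add: dot_def axis_def if_distrib cong: if_cong)

lemma dot_matrix_mult: "dot (M *v u) v = dot u (Finite_Cartesian_Product.transpose M *v v)"
  unfolding dot_def matrix_vector_mult_def Finite_Cartesian_Product.transpose_def
  by (simp add: sum_distrib_left sum_distrib_right, subst sum.swap) (simp add: mult_ac)

text \<open>For nonzero \<open>q\<close> this is membership in the regular vectors divided by
  \<open>q\<close>, stated without inverses.\<close>

definition clears :: "'n::{finite,linorder} mpoly \<Rightarrow> ('n ratfun, 'n) vec \<Rightarrow> bool"
  where "clears q v \<longleftrightarrow> (\<forall>i. emb q * v $ i \<in> range emb)"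

lemma clears_matrix_mult:
  assumes "clears q v" "\<And>i j. M $ i $ j \<in> range emb"
  shows "clears q (M *v v)"
  unfolding clears_def
proof
  fix i
  have "(\<Sum>j\<in>UNIV. M $ i $ j * (emb q * v $ j)) \<in> range emb"
    using assms by (intro range_emb_sum range_emb_mult[OF assms(2)]) (simp add: clears_def)
  then show "emb q * (M *v v) $ i \<in> range emb"
    by (simp add: matrix_vector_mult_def sum_distrib_left mult_ac)
qed

text \<open>\<open>l H\<close> abstracts the equation of \<open>H\<close>, \<open>G\<close> the Gram
  matrix of the inner product and \<open>B\<close> its inverse. By \<open>unit_coeff\<close> some
  coefficient of the gradient can be divided by without creating a pole.\<close>

locale prime_family =
  fixes A :: "'h set"
    and l :: "'h \<Rightarrow> 'n::{finite,linorder} mpoly"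
    and G B :: "(('n ratfun, 'n) vec, 'n) vec"
  assumes fin: "finite A"
    and prime: "H \<in> A \<Longrightarrow> prime_elem (l H)"
    and not_dvd: "H \<in> A \<Longrightarrow> H' \<in> A \<Longrightarrow> H \<noteq> H' \<Longrightarrow> \<not> l H dvd l H'"
    and unit_coeff: "H \<in> A \<Longrightarrow> \<exists>j u. emb u * ext_d (l H) $ j = 1"
    and G_range: "G $ i $ j \<in> range emb"
    and B_range: "B $ i $ j \<in> range emb"
    and G_sym: "Finite_Cartesian_Product.transpose G = G"
    and B_sym: "Finite_Cartesian_Product.transpose B = B"
    and GB: "G ** B = mat 1"
    and BG: "B ** G = mat 1"
begin

abbreviation grad :: "'h \<Rightarrow> 'n rat_form"
  where "grad H \<equiv> ext_d (l H)"

text \<open>Since \<open>nat\<close> truncates, \<open>den m\<close> is the product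
  \<open>Q_+\<close>, and \<open>den (\<lambda>H. - m H)\<close> is \<open>Q_-\<close>.\<close>

definition den :: "('h \<Rightarrow> int) \<Rightarrow> 'n mpoly"
  where "den m = (\<Prod>H\<in>A. l H ^ nat (m H))"

definition den_except :: "'h \<Rightarrow> ('h \<Rightarrow> int) \<Rightarrow> 'n mpoly"
  where "den_except K m = (\<Prod>H\<in>A - {K}. l H ^ nat (m H))"

text \<open>The generalized logarithmic module in coordinates. Both submodules being intersected
  have the denominator \<open>Q_-\<close>, so \<open>clears\<close> occurs once;
  \<open>B *v \<delta>\<close> is the form that the inner product assigns to
  \<open>\<delta>\<close>.\<close>

definition dmod :: "('h \<Rightarrow> int) \<Rightarrow> 'n rat_der set"
  where "dmod m = {\<delta>. clears (den (\<lambda>H. - m H)) \<delta> \<and>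
    (\<forall>H\<in>A. m H > 0 \<longrightarrow>
      (\<exists>s. emb (den (\<lambda>H. - m H)) * dot \<delta> (grad H) = emb (s * l H ^ nat (m H)))) \<and>
    (\<forall>H\<in>A. m H < 0 \<longrightarrow> form2_regular_along (l H) (wedge (grad H) (B *v \<delta>)))}"

definition pairing :: "'n rat_der \<Rightarrow> 'n rat_der \<Rightarrow> 'n ratfun"
  where "pairing \<delta> \<eta> = dot (B *v \<delta>) \<eta>"

lemma pairing_commute: "pairing \<delta> \<eta> = pairing \<eta> \<delta>"
  by (metis pairing_def dot_matrix_mult B_sym dot_commute)

lemma grad_range: "grad H $ i \<in> range emb"
  by (simp add: ext_d_def)

lemma G_B_vec [simp]: "G *v (B *v v) = v" and B_G_vec [simp]: "B *v (G *v v) = v"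
  by (simp_all add: matrix_vector_mul_assoc GB BG)

lemma l_nonzero: "H \<in> A \<Longrightarrow> l H \<noteq> 0"
  using prime by (auto simp: prime_elem_def)

lemma den_nonzero: "den m \<noteq> 0"
  using l_nonzero fin by (auto simp: den_def)

lemma den_split:
  assumes "H \<in> A"
  shows "den m = l H ^ nat (m H) * den_except H m"
  unfolding den_def den_except_def using fin assms by (rule prod.remove)

lemma not_dvd_den_except:
  assumes "H \<in> A"
  shows "\<not> l H dvd den_except H m"
proof
  assume "l H dvd den_except H m"
  then obtain K where K: "K \<in> A - {H}" "l H dvd l K ^ nat (m K)"
    using prime_elem_dvd_prod[OF prime[OF assms]] fin unfolding den_except_def by blast
  then have "l H dvd l K"
    using prime[OF assms] prime_elem_dvd_power by blast
  then show False using not_dvd assms K by auto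
qed

lemma not_dvd_den:
  assumes "H \<in> A" "m H \<le> 0"
  shows "\<not> l H dvd den m"
  using not_dvd_den_except[OF assms(1)] assms(2) by (simp add: den_split[OF assms(1)])

section \<open>The pairing has polynomial values\<close>

lemma wedge_component: "wedge u v $ i $ j = u $ i * v $ j - u $ j * v $ i"
  by (simp add: wedge_def)

text \<open>The pairing splits into a tangential part, controlled by the wedge condition on
  \<open>\<eta>\<close>, and a normal part, in which the zero of
  \<open>dot \<delta> (grad H)\<close> along \<open>H\<close> compensates the pole of
  \<open>\<eta>\<close>.\<close>

lemma pairing_regular_along:
  assumes H: "H \<in> A" "m H > 0" and \<delta>: "\<delta> \<in> dmod m" and \<eta>: "\<eta> \<in> dmod (\<lambda>H. - m H)"
  shows "regular_along (l H) (pairing \<delta> \<eta>)"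
proof -
  note prime = prime[OF H(1)]
  define \<zeta> where "\<zeta> = B *v \<eta>"
  define q where "q = den (\<lambda>H. - m H)"
  \<comment> \<open>As \<open>m H\<close> is positive, the exponent of \<open>l H\<close> in
    \<open>q\<close> is 0.\<close>
  have q: "\<not> l H dvd q"
    using H by (simp add: q_def not_dvd_den)
  obtain j u where u: "emb u * grad H $ j = 1"
    using unit_coeff H(1) by blast
  have reg_\<delta>: "regular_along (l H) (\<delta> $ i)" for i
    using \<delta> q by (intro regular_alongI[of _ q]) (auto simp: dmod_def clears_def q_def)
  have reg_wedge: "regular_along (l H) (grad H $ i * \<zeta> $ k - grad H $ k * \<zeta> $ i)" for i k
    using \<eta> H by (auto simp: dmod_def \<zeta>_def form2_regular_along_def wedge_component)
  obtain s where s: "emb q * dot \<delta> (grad H) = emb (s * l H ^ nat (m H))"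
    using \<delta> H unfolding dmod_def q_def by blast
  have "clears (den m) \<zeta>"
    unfolding \<zeta>_def using \<eta> by (intro clears_matrix_mult B_range) (auto simp: dmod_def)
  then have "emb s * (emb (den m) * \<zeta> $ j) \<in> range emb"
    by (auto simp: clears_def intro: range_emb_mult)
  \<comment> \<open>The power of \<open>l H\<close> in \<open>den m\<close> combines with
    \<open>s\<close> to a multiple of \<open>dot \<delta> (grad H)\<close>; the multiplier that
    remains is not divisible by \<open>l H\<close>.\<close>
  also have "emb s * (emb (den m) * \<zeta> $ j)
      = emb (q * den_except H m) * (\<zeta> $ j * dot \<delta> (grad H))"
    using s by (simp add: den_split[OF H(1)] emb_mult mult_ac)
  finally have reg_normal: "regular_along (l H) (\<zeta> $ j * dot \<delta> (grad H))"
    using q not_dvd_den_except[OF H(1)] prime_elem_dvd_mult_iff[OF prime]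
    by (intro regular_alongI[of _ "q * den_except H m"]) simp_all
  have "pairing \<delta> \<eta> = dot \<delta> \<zeta>"
    by (simp add: pairing_def \<zeta>_def dot_matrix_mult B_sym)
  also have "\<dots> = emb u * (grad H $ j * dot \<delta> \<zeta>)"
    using u by (simp add: mult.assoc[symmetric])
  \<comment> \<open>Adding and subtracting \<open>\<zeta> $ j * dot \<delta> (grad H)\<close>
    exhibits the coefficients of the wedge product.\<close>
  also have "grad H $ j * dot \<delta> \<zeta>
      = (\<Sum>i\<in>UNIV. \<delta> $ i * (grad H $ j * \<zeta> $ i - grad H $ i * \<zeta> $ j)) + \<zeta> $ j * dot \<delta> (grad H)"
    by (simp add: dot_def sum_distrib_left right_diff_distrib sum_subtractf mult_ac)
  finally show ?thesis
    by (simp only:) (intro regular_along_mult regular_along_add regular_along_sum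
        regular_along_emb prime reg_\<delta> reg_wedge reg_normal rangeI)
qed

lemma pairing_range:
  assumes \<delta>: "\<delta> \<in> dmod m" and \<eta>: "\<eta> \<in> dmod (\<lambda>H. - m H)"
  shows "pairing \<delta> \<eta> \<in> range emb"
proof (rule regular_along_cancel_prod[OF fin prime])
  fix H assume H: "H \<in> A" "nat \<bar>m H\<bar> > 0"
  show "regular_along (l H) (pairing \<delta> \<eta>)"
  proof (cases "m H > 0")
    case True
    then show ?thesis using H assms by (intro pairing_regular_along) auto
  next
    \<comment> \<open>Here \<open>m H\<close> is negative, and by symmetry of the pairing the two
      arguments exchange roles.\<close>
    case False
    then show ?thesis
      using H assms unfolding pairing_commute[of \<delta>]
      by (intro pairing_regular_along[of _ "\<lambda>H. - m H"]) auto
  qed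
next
  \<comment> \<open>At each \<open>H\<close> at most one of the two truncated exponents is nonzero,
    so they add up to the absolute value.\<close>
  have "den (\<lambda>H. - m H) * den m = (\<Prod>H\<in>A. l H ^ nat \<bar>m H\<bar>)"
    unfolding den_def prod.distrib[symmetric] power_add[symmetric]
    by (intro prod.cong refl arg_cong[where f = "\<lambda>k. _ ^ k"]) auto
  moreover have "clears (den (\<lambda>H. - m H)) (B *v \<delta>)" "clears (den m) \<eta>"
    using assms by (auto simp: dmod_def intro: clears_matrix_mult B_range)
  then have "(\<Sum>i\<in>UNIV. (emb (den (\<lambda>H. - m H)) * (B *v \<delta>) $ i) * (emb (den m) * \<eta> $ i)) \<in> range emb"
    by (intro range_emb_sum, unfold clears_def) (rule range_emb_mult, blast, blast)
  ultimately show "emb (\<Prod>H\<in>A. l H ^ nat \<bar>m H\<bar>) * pairing \<delta> \<eta> \<in> range emb"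
    by (simp add: pairing_def dot_def sum_distrib_left emb_mult mult_ac flip: \<open>_ = prod _ _\<close>)
qed

section \<open>Test elements of the modules\<close>

lemma dmodI_regular:
  assumes v: "\<And>i. v $ i \<in> range emb"
    and dvd: "\<And>H. H \<in> A \<Longrightarrow> m H > 0 \<Longrightarrow> \<exists>s. dot v (grad H) = emb (s * l H ^ nat (m H))"
  shows "v \<in> dmod m"
proof -
  have "clears q v" for q
    using v by (auto simp: clears_def intro!: range_emb_mult)
  moreover have "\<exists>s. emb q * dot v (grad H) = emb (s * l H ^ nat (m H))"
    if H: "H \<in> A" "m H > 0" for H q
  proof -
    obtain s where "dot v (grad H) = emb (s * l H ^ nat (m H))"
      using dvd H by blast
    then have "emb q * dot v (grad H) = emb (q * s * l H ^ nat (m H))"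
      by (simp add: emb_mult mult.assoc)
    then show ?thesis ..
  qed
  \<comment> \<open>A regular vector yields a regular 2-form, so the pole condition holds along
    every \<open>H\<close>.\<close>
  moreover have "form2_regular_along (l H) (wedge (grad H) (B *v v))" if "H \<in> A" for H
  proof -
    have "clears 1 (B *v v)"
      using \<open>clears 1 v\<close> by (rule clears_matrix_mult) (rule B_range)
    then have "wedge (grad H) (B *v v) $ i $ j \<in> range emb" for i j
      unfolding wedge_component diff_conv_add_uminus
      by (intro range_emb_add range_emb_uminus range_emb_mult grad_range) (simp_all add: clears_def)
    then show ?thesis
      using prime[OF that] by (simp add: form2_regular_along_def regular_along_emb)
  qed
  ultimately show ?thesis
    by (simp add: dmod_def)
qed

text \<open>\<open>den m\<close> contains every required power \<open>l H ^ nat (m H)\<close>.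
  Values on these elements determine a functional.\<close>

lemma axis_in_dmod: "axis i (emb (den m)) \<in> dmod m"
proof (rule dmodI_regular)
  show "axis i (emb (den m)) $ j \<in> range emb" for j
    by (simp add: axis_def)
  fix H assume H: "H \<in> A" "m H > 0"
  obtain g where "grad H $ i = emb g"
    using grad_range by auto
  then have "dot (axis i (emb (den m))) (grad H) = emb (g * den_except H m * l H ^ nat (m H))"
    by (simp add: dot_commute[of "axis i _"] dot_axis den_split[OF H(1)] emb_mult mult_ac)
  then show "\<exists>s. dot (axis i (emb (den m))) (grad H) = emb (s * l H ^ nat (m H))" ..
qed

text \<open>\<open>u i j\<close> is orthogonal to the gradient of \<open>l H\<close>, and
  \<open>den_except H m\<close> supplies the zeros along the other hyperplanes. Pairing with these
  elements reads off the wedge coefficients at \<open>H\<close>.\<close>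

lemma tangential_in_dmod:
  assumes H: "H \<in> A"
  defines "u i j \<equiv> grad H $ i *s axis j 1 - grad H $ j *s axis i 1"
  shows "emb (den_except H m) *s u i j \<in> dmod m"
proof (rule dmodI_regular)
  have u: "u i j $ k \<in> range emb" for k
    using grad_range unfolding u_def axis_def diff_conv_add_uminus
    by (auto intro!: range_emb_add range_emb_uminus)
  then show "(emb (den_except H m) *s u i j) $ k \<in> range emb" for k
    by (auto intro!: range_emb_mult)
  fix K assume K: "K \<in> A" "m K > 0"
  show "\<exists>s. dot (emb (den_except H m) *s u i j) (grad K) = emb (s * l K ^ nat (m K))"
  proof (cases "K = H")
    case True
    have "dot (u i j) (grad H) = 0"
      by (simp add: u_def dot_commute[of _ "grad H"] dot_diff_right
          dot_scale_right dot_axis)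
    then have "dot (emb (den_except H m) *s u i j) (grad K) = emb (0 * l K ^ nat (m K))"
      by (simp add: True dot_scale)
    then show ?thesis ..
  next
    case False
    have "dot (u i j) (grad K) \<in> range emb"
      unfolding dot_def by (intro range_emb_sum range_emb_mult u grad_range)
    then obtain g where g: "dot (u i j) (grad K) = emb g"
      by auto
    have "l K ^ nat (m K) dvd den_except H m"
      unfolding den_except_def using fin K False by (intro dvd_prodI) auto
    then obtain q where "den_except H m = l K ^ nat (m K) * q" ..
    then have "dot (emb (den_except H m) *s u i j) (grad K) = emb (q * g * l K ^ nat (m K))"
      by (simp add: dot_scale g emb_mult mult_ac)
    then show ?thesis ..
  qed
qed

text \<open>\<open>B\<close> turns this element into a multiple of \<open>grad H\<close>, so its
  pole along \<open>H\<close> disappears in the wedge with \<open>grad H\<close>. Pairing with it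
  tests divisibility by the power of \<open>l H\<close> in the dual module.\<close>

lemma normal_in_dmod:
  assumes H: "H \<in> A" "m H < 0"
  shows "(emb (den m) / emb (l H ^ nat (- m H))) *s (G *v grad H) \<in> dmod m"
proof -
  define c where "c = emb (den m) / emb (l H ^ nat (- m H))"
  \<comment> \<open>The power of \<open>l H\<close> in the denominator of \<open>c\<close> is
    exactly the one contained in \<open>den (\<lambda>H. - m H)\<close>.\<close>
  have c_den: "emb (den (\<lambda>H. - m H)) * c = emb (den_except H (\<lambda>H. - m H) * den m)"
    using l_nonzero[OF H(1)] by (simp add: c_def den_split[OF H(1), of "\<lambda>H. - m H"] emb_mult)
  have "clears 1 (G *v grad H)"
    by (rule clears_matrix_mult) (simp_all add: clears_def grad_range G_range)
  then have Gg: "(G *v grad H) $ i \<in> range emb" for i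
    by (simp add: clears_def)
  have "clears (den (\<lambda>H. - m H)) (c *s (G *v grad H))"
    unfolding clears_def vector_smult_component mult.assoc[symmetric] c_den
    by (intro allI range_emb_mult Gg) simp
  moreover have "\<exists>s. emb (den (\<lambda>H. - m H)) * dot (c *s (G *v grad H)) (grad K)
      = emb (s * l K ^ nat (m K))" if K: "K \<in> A" "m K > 0" for K
  proof -
    have "dot (G *v grad H) (grad K) \<in> range emb"
      unfolding dot_def by (intro range_emb_sum range_emb_mult Gg grad_range)
    then obtain g where "dot (G *v grad H) (grad K) = emb g"
      by auto
    then have "emb (den (\<lambda>H. - m H)) * dot (c *s (G *v grad H)) (grad K)
        = emb (den_except H (\<lambda>H. - m H) * den_except K m * g * l K ^ nat (m K))"
      unfolding dot_scale mult.assoc[symmetric] c_den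
      by (simp add: den_split[OF K(1), of m] emb_mult mult_ac)
    then show ?thesis ..
  qed
  moreover have "form2_regular_along (l K) (wedge (grad K) (B *v (c *s (G *v grad H))))"
    if K: "K \<in> A" "m K < 0" for K
    unfolding form2_regular_along_def
  proof (intro allI)
    fix i j
    define w where "w = grad K $ i * grad H $ j - grad K $ j * grad H $ i"
    have w: "wedge (grad K) (B *v (c *s (G *v grad H))) $ i $ j = c * w"
      by (simp add: wedge_component vector_scalar_commute w_def algebra_simps)
    show "regular_along (l K) (wedge (grad K) (B *v (c *s (G *v grad H))) $ i $ j)"
    proof (cases "K = H")
      \<comment> \<open>The two gradients coincide, so \<open>w\<close> vanishes.\<close>
      case True
      then show ?thesis
        unfolding w using prime[OF K(1)] by (simp add: w_def mult.commute regular_along_emb)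
    next
      \<comment> \<open>The denominator of \<open>c\<close> is a power of \<open>l H\<close>, which
        \<open>l K\<close> does not divide.\<close>
      case False
      then have "\<not> l K dvd l H ^ nat (- m H)"
        using not_dvd[OF K(1) H(1)] prime[OF K(1)] prime_elem_dvd_power by blast
      moreover have "w \<in> range emb"
        unfolding w_def diff_conv_add_uminus
        by (intro range_emb_add range_emb_uminus range_emb_mult grad_range)
      then have "emb (den m) * w \<in> range emb"
        by (intro range_emb_mult) simp_all
      then have "emb (l H ^ nat (- m H)) * (c * w) \<in> range emb"
        using l_nonzero[OF H(1)] by (simp add: c_def)
      ultimately show ?thesis
        unfolding w by (rule regular_alongI)
    qed
  qed
  ultimately show ?thesis
    by (simp add: dmod_def c_def)
qed

section \<open>Closure under the module operations\<close>

lemma subspace_dmod: "module.subspace vec_scale (dmod m)"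
  unfolding module.subspace_def[OF module_vec_scale]
proof (intro conjI ballI allI)
  show "0 \<in> dmod m"
    by (rule dmodI_regular) (auto simp: dot_def intro: exI[of _ 0])
next
  fix v w assume v: "v \<in> dmod m" and w: "w \<in> dmod m"
  let ?q = "den (\<lambda>H. - m H)"
  have "clears ?q (v + w)"
    using v w by (auto simp: dmod_def clears_def distrib_left intro!: range_emb_add)
  moreover have "\<exists>s. emb ?q * dot (v + w) (grad H) = emb (s * l H ^ nat (m H))"
    if H: "H \<in> A" "m H > 0" for H
  proof -
    obtain s t where "emb ?q * dot v (grad H) = emb (s * l H ^ nat (m H))"
        "emb ?q * dot w (grad H) = emb (t * l H ^ nat (m H))"
      using v w H unfolding dmod_def by blast
    then have "emb ?q * dot (v + w) (grad H) = emb ((s + t) * l H ^ nat (m H))"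
      by (simp add: dot_add distrib_left distrib_right emb_add)
    then show ?thesis ..
  qed
  moreover have "form2_regular_along (l H) (wedge (grad H) (B *v (v + w)))"
    if H: "H \<in> A" "m H < 0" for H
    unfolding form2_regular_along_def
  proof (intro allI)
    fix i j
    have "wedge (grad H) (B *v (v + w)) $ i $ j
        = wedge (grad H) (B *v v) $ i $ j + wedge (grad H) (B *v w) $ i $ j"
      by (simp add: wedge_component matrix_vector_right_distrib algebra_simps)
    then show "regular_along (l H) (wedge (grad H) (B *v (v + w)) $ i $ j)"
      using v w H
      by (auto simp: dmod_def form2_regular_along_def intro: regular_along_add[OF prime])
  qed
  ultimately show "v + w \<in> dmod m"
    by (simp add: dmod_def)
next
  fix c v assume v: "v \<in> dmod m"
  let ?q = "den (\<lambda>H. - m H)"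
  have "emb c * (emb ?q * v $ i) \<in> range emb" for i
    by (rule range_emb_mult[OF rangeI]) (use v in \<open>simp add: dmod_def clears_def\<close>)
  then have "clears ?q (vec_scale c v)"
    by (simp add: clears_def vec_scale_def mult.left_commute)
  moreover have "\<exists>s. emb ?q * dot (vec_scale c v) (grad H) = emb (s * l H ^ nat (m H))"
    if H: "H \<in> A" "m H > 0" for H
  proof -
    obtain s where "emb ?q * dot v (grad H) = emb (s * l H ^ nat (m H))"
      using v H unfolding dmod_def by blast
    then have "emb ?q * dot (vec_scale c v) (grad H) = emb (c * s * l H ^ nat (m H))"
      by (simp add: vec_scale_def dot_scale mult.left_commute[of "emb ?q"])
        (simp add: emb_mult mult.assoc)
    then show ?thesis ..
  qed
  moreover have "form2_regular_along (l H) (wedge (grad H) (B *v vec_scale c v))"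
    if H: "H \<in> A" "m H < 0" for H
    unfolding form2_regular_along_def
  proof (intro allI)
    fix i j
    have "wedge (grad H) (B *v vec_scale c v) $ i $ j = emb c * wedge (grad H) (B *v v) $ i $ j"
      by (simp add: wedge_component vec_scale_def vector_scalar_commute algebra_simps)
    moreover have "regular_along (l H) (wedge (grad H) (B *v v) $ i $ j)"
      using v H by (simp add: dmod_def form2_regular_along_def)
    ultimately show "regular_along (l H) (wedge (grad H) (B *v vec_scale c v) $ i $ j)"
      using regular_along_mult regular_along_emb prime[OF H(1)] by (metis rangeI)
  qed
  ultimately show "vec_scale c v \<in> dmod m"
    by (simp add: dmod_def)
qed

section \<open>Perfectness of the pairing\<close>

definition spairing :: "'n rat_der \<Rightarrow> 'n rat_der \<Rightarrow> 'n mpoly"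
  where "spairing \<delta> \<eta> = the_inv emb (pairing \<delta> \<eta>)"

lemma spairing_commute: "spairing \<delta> \<eta> = spairing \<eta> \<delta>"
  by (simp add: spairing_def pairing_commute)

text \<open>\<open>the_inv\<close> is meaningful only on the range of \<open>emb\<close>, where
  \<open>pairing_range\<close> places the value.\<close>

lemma emb_spairing:
  assumes "\<delta> \<in> dmod m" "\<eta> \<in> dmod (\<lambda>H. - m H)"
  shows "emb (spairing \<delta> \<eta>) = pairing \<delta> \<eta>"
  unfolding spairing_def using pairing_range[OF assms] by (intro f_the_inv_into_f) (auto simp: inj_def)

lemma spairing_hom:
  assumes \<delta>: "\<delta> \<in> dmod m"
  shows "restrict (spairing \<delta>) (dmod (\<lambda>H. - m H)) \<in> hom_ring vec_scale (dmod (\<lambda>H. - m H))"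
proof -
  let ?N = "dmod (\<lambda>H. - m H)"
  note closed = subspace_dmod[of "\<lambda>H. - m H", unfolded module.subspace_def[OF module_vec_scale]]
  have "spairing \<delta> (y + z) = spairing \<delta> y + spairing \<delta> z" if "y \<in> ?N" "z \<in> ?N" for y z
  proof -
    have "emb (spairing \<delta> (y + z)) = emb (spairing \<delta> y + spairing \<delta> z)"
      using that closed
      by (simp add: emb_add emb_spairing[OF \<delta>] pairing_def dot_add_right)
    then show ?thesis by simp
  qed
  moreover have "spairing \<delta> (vec_scale c y) = c * spairing \<delta> y" if "y \<in> ?N" for c y
  proof -
    have "emb (spairing \<delta> (vec_scale c y)) = emb (c * spairing \<delta> y)"
      using that closed emb_spairing[OF \<delta>, of "vec_scale c y"]
      by (simp add: emb_mult emb_spairing[OF \<delta>] pairing_def vec_scale_def dot_scale_right)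
    then show ?thesis by simp
  qed
  ultimately show ?thesis
    using closed by (simp add: hom_ring_def)
qed

text \<open>
  Every functional is \<open>dot \<psi>\<close> for a rational vector \<open>\<psi>\<close>, as the module contains a multiple
  of each basis vector and has bounded denominators.
\<close>

lemma hom_conv_dot:
  assumes f: "f \<in> hom_ring vec_scale (dmod m)" and v: "v \<in> dmod m"
  shows "emb (f v) = dot (\<chi> i. emb (f (axis i (emb (den m)))) / emb (den m)) v"
proof -
  interpret module "vec_scale :: 'n mpoly \<Rightarrow> _"
    by (rule module_vec_scale)
  let ?q = "den (\<lambda>H. - m H)"
  note sub = subspace_dmod[of m]
  have f_add: "f (y + z) = f y + f z" if "y \<in> dmod m" "z \<in> dmod m" for y z
    using f that by (simp add: hom_ring_def)
  have f_scale: "f (vec_scale c y) = c * f y" if "y \<in> dmod m" for c y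
    using f that by (simp add: hom_ring_def)
  have f_0: "f 0 = 0"
    using f_scale[OF v, of 0] by simp
  have f_sum: "f (\<Sum>t\<in>T. g t) = (\<Sum>t\<in>T. f (g t))" if "\<And>t. g t \<in> dmod m" for T :: "'n set" and g
    by (induction T rule: infinite_finite_induct)
      (use that sub in \<open>simp_all add: f_0 f_add subspace_sum\<close>)
  have "\<forall>i. \<exists>p. emb ?q * v $ i = emb p"
    using v unfolding dmod_def clears_def by auto
  then obtain p where p: "\<And>i. emb ?q * v $ i = emb (p i)"
    by metis
  then have p': "v $ i * emb ?q = emb (p i)" for i
    by (simp add: mult.commute)
  \<comment> \<open>Clearing denominators turns a multiple of \<open>v\<close> into a polynomial
    combination of the axis test elements, to which linearity of \<open>f\<close> applies.\<close>
  have "vec_scale (den m * ?q) v = (\<Sum>i\<in>UNIV. vec_scale (p i) (axis i (emb (den m))))"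
    by (simp add: vec_eq_iff vec_scale_def axis_def if_distrib emb_mult mult.assoc p p'
        mult.commute cong: if_cong)
  then have "den m * ?q * f v = (\<Sum>i\<in>UNIV. p i * f (axis i (emb (den m))))"
    using v by (simp add: f_sum f_scale axis_in_dmod subspace_scale[OF sub] flip: f_scale)
  then have "emb (den m * ?q * f v) = emb (\<Sum>i\<in>UNIV. p i * f (axis i (emb (den m))))"
    by simp
  also have "\<dots> = (\<Sum>i\<in>UNIV. emb (p i) * emb (f (axis i (emb (den m)))))"
    by (induction rule: infinite_finite_induct) (simp_all add: emb_add emb_mult)
  also have "\<dots> = emb (den m * ?q) * dot (\<chi> i. emb (f (axis i (emb (den m)))) / emb (den m)) v"
    by (simp add: dot_def sum_distrib_left den_nonzero emb_mult mult_ac flip: p)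
  finally show ?thesis
    by (simp add: emb_mult den_nonzero)
qed

text \<open>\<open>G\<close> carries the vector representing \<open>f\<close> to a derivation.
  Normal test elements force its zeros where \<open>m\<close> is positive; tangential ones exclude
  forbidden poles where \<open>m\<close> is negative.\<close>

lemma spairing_surj:
  assumes f: "f \<in> hom_ring vec_scale (dmod (\<lambda>H. - m H))"
  shows "\<exists>\<delta>\<in>dmod m. f = restrict (spairing \<delta>) (dmod (\<lambda>H. - m H))"
proof -
  define n where "n = (\<lambda>H. - m H)"
  define \<psi> where "\<psi> = (\<chi> i. emb (f (axis i (emb (den n)))) / emb (den n))"
  define \<delta> where "\<delta> = G *v \<psi>"
  have f_dot: "emb (f v) = dot \<psi> v" if "v \<in> dmod n" for v
    unfolding \<psi>_def using f that by (intro hom_conv_dot) (simp_all add: n_def)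
  have "clears (den n) \<psi>"
    by (simp add: clears_def \<psi>_def den_nonzero)
  then have "clears (den n) \<delta>"
    unfolding \<delta>_def by (intro clears_matrix_mult G_range)
  moreover have "\<exists>s. emb (den n) * dot \<delta> (grad H) = emb (s * l H ^ nat (m H))"
    if H: "H \<in> A" "m H > 0" for H
  proof -
    define w where "w = (emb (den n) / emb (l H ^ nat (m H))) *s (G *v grad H)"
    have "w \<in> dmod n"
      using normal_in_dmod[of H n] H by (simp add: w_def n_def)
    \<comment> \<open>Symmetry of \<open>G\<close> moves it from the gradient onto
      \<open>\<psi>\<close>, which becomes \<open>\<delta>\<close>.\<close>
    then have "emb (f w) = emb (den n) / emb (l H ^ nat (m H)) * dot \<delta> (grad H)"
      by (simp add: f_dot) (simp add: w_def \<delta>_def dot_scale_right dot_matrix_mult G_sym)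
    then have "emb (den n) * dot \<delta> (grad H) = emb (f w * l H ^ nat (m H))"
      using l_nonzero[OF H(1)] by (simp add: emb_mult)
    then show ?thesis ..
  qed
  moreover have "form2_regular_along (l H) (wedge (grad H) (B *v \<delta>))" if H: "H \<in> A" "m H < 0" for H
    unfolding form2_regular_along_def
  proof (intro allI)
    fix i j
    define w where "w = emb (den_except H n) *s (grad H $ i *s axis j 1 - grad H $ j *s axis i 1)"
    have "w \<in> dmod n"
      unfolding w_def using H(1) by (rule tangential_in_dmod)
    then have "emb (f w) = emb (den_except H n) * wedge (grad H) (B *v \<delta>) $ i $ j"
      by (simp add: f_dot)
        (simp add: w_def \<delta>_def wedge_component dot_scale_right dot_diff_right
          dot_axis)
    \<comment> \<open>The product is a value of \<open>f\<close>, hence polynomial, and its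
      multiplier is not divisible by \<open>l H\<close>.\<close>
    then have "emb (den_except H n) * wedge (grad H) (B *v \<delta>) $ i $ j \<in> range emb"
      by (metis rangeI)
    then show "regular_along (l H) (wedge (grad H) (B *v \<delta>) $ i $ j)"
      by (rule regular_alongI[OF not_dvd_den_except[OF H(1)]])
  qed
  ultimately have \<delta>: "\<delta> \<in> dmod m"
    by (simp add: dmod_def n_def)
  have "f \<eta> = restrict (spairing \<delta>) (dmod n) \<eta>" for \<eta>
  proof (cases "\<eta> \<in> dmod n")
    case True
    then have "emb (f \<eta>) = emb (spairing \<delta> \<eta>)"
      using emb_spairing[OF \<delta>] by (simp add: f_dot n_def pairing_def \<delta>_def)
    then show ?thesis using True by simp
  next
    \<comment> \<open>Off the module both functions are \<open>undefined\<close>, by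
      extensionality.\<close>
    case False
    then show ?thesis
      using f by (auto simp: hom_ring_def n_def extensional_def)
  qed
  then show ?thesis
    using \<delta> unfolding n_def by blast
qed

text \<open>For injectivity, pairing with the axis test elements recovers the coordinates of
  \<open>B *v \<delta>\<close>, and \<open>B\<close> is invertible.\<close>

lemma spairing_bij:
  "bij_betw (\<lambda>\<delta>. restrict (spairing \<delta>) (dmod (\<lambda>H. - m H)))
    (dmod m) (hom_ring vec_scale (dmod (\<lambda>H. - m H)))"
proof (rule bij_betw_imageI)
  let ?n = "\<lambda>H. - m H"
  show "inj_on (\<lambda>\<delta>. restrict (spairing \<delta>) (dmod ?n)) (dmod m)"
  proof (rule inj_onI)
    fix \<delta> \<delta>' assume in_dmod: "\<delta> \<in> dmod m" "\<delta>' \<in> dmod m"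
      and eq: "restrict (spairing \<delta>) (dmod ?n) = restrict (spairing \<delta>') (dmod ?n)"
    have "(B *v \<delta>) $ i = (B *v \<delta>') $ i" for i
    proof -
      define \<eta> :: "'n rat_der" where "\<eta> = axis i (emb (den ?n))"
      have \<eta>: "\<eta> \<in> dmod ?n"
        unfolding \<eta>_def by (rule axis_in_dmod)
      then have "spairing \<delta> \<eta> = spairing \<delta>' \<eta>"
        using fun_cong[OF eq, of \<eta>] by simp
      then have "pairing \<delta> \<eta> = pairing \<delta>' \<eta>"
        using emb_spairing[OF _ \<eta>] in_dmod by metis
      then show ?thesis
        by (simp add: pairing_def \<eta>_def dot_axis den_nonzero)
    qed
    then have "B *v \<delta> = B *v \<delta>'"
      by (simp add: vec_eq_iff)
    then show "\<delta> = \<delta>'"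
      by (metis G_B_vec)
  qed
  show "(\<lambda>\<delta>. restrict (spairing \<delta>) (dmod ?n)) ` dmod m = hom_ring vec_scale (dmod ?n)"
    using spairing_hom spairing_surj by blast
qed

theorem dual_modules_dmod:
  "dual_modules vec_scale (dmod m) vec_scale (dmod (\<lambda>H. - m H))"
proof -
  \<comment> \<open>Negating twice restores \<open>m\<close> and the pairing is symmetric, so this
    is the first bijection taken at \<open>-m\<close>.\<close>
  have "bij_betw (\<lambda>\<eta>. restrict (\<lambda>\<delta>. spairing \<delta> \<eta>) (dmod m))
      (dmod (\<lambda>H. - m H)) (hom_ring vec_scale (dmod m))"
    using spairing_bij[of "\<lambda>H. - m H"] by (simp add: spairing_commute[of _ _])
  then show ?thesis
    unfolding dual_modules_def
    using spairing_bij module_vec_scale subspace_dmod by blast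
qed

end

section \<open>Extension of scalars from the real numbers\<close>

definition real_emb :: "real \<Rightarrow> 'n::{finite,linorder} ratfun"
  where "real_emb r = emb (Const (complex_of_real r))"

lemma real_emb_0 [simp]: "real_emb 0 = 0"
  and real_emb_1 [simp]: "real_emb 1 = 1"
  and real_emb_add: "real_emb (r + s) = real_emb r + real_emb s"
  and real_emb_mult: "real_emb (r * s) = real_emb r * real_emb s"
  by (simp_all add: real_emb_def Const_add Const_mult emb_add emb_mult)

lemma real_emb_sum: "real_emb (\<Sum>t\<in>T. f t) = (\<Sum>t\<in>T. real_emb (f t))"
  by (induction T rule: infinite_finite_induct) (simp_all add: real_emb_add)

definition emb_matrix :: "((real, 'n) vec, 'n) vec \<Rightarrow> (('n::{finite,linorder} ratfun, 'n) vec, 'n) vec"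
  where "emb_matrix M = (\<chi> i j. real_emb (M $ i $ j))"

text \<open>Through this the inverse of the Gram matrix, found over the reals where positivity is
  available, carries over to the fraction field.\<close>

lemma emb_matrix_mult: "emb_matrix (M ** N) = emb_matrix M ** emb_matrix N"
  by (simp add: vec_eq_iff emb_matrix_def matrix_matrix_mult_def real_emb_sum real_emb_mult)

lemma emb_matrix_1: "emb_matrix (mat 1) = mat 1"
  by (simp add: vec_eq_iff emb_matrix_def mat_def)

lemma transpose_emb_matrix:
  "Finite_Cartesian_Product.transpose (emb_matrix M)
    = emb_matrix (Finite_Cartesian_Product.transpose M)"
  by (simp add: vec_eq_iff emb_matrix_def Finite_Cartesian_Product.transpose_def)

lemma emb_matrix_range: "emb_matrix M $ i $ j \<in> range emb"
  by (simp add: emb_matrix_def real_emb_def)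


section \<open>The Gram matrix and the defining forms\<close>

lemma dual_coords_eq:
  assumes "dual_basis x" "linear f"
  shows "f = (\<lambda>v. \<Sum>i\<in>UNIV. dual_coords x f i * x i v)"
proof -
  have "\<exists>!c. f = (\<lambda>v. \<Sum>i\<in>UNIV. c i * x i v)"
    using assms by (simp add: dual_basis_def)
  then show ?thesis
    unfolding dual_coords_def by (rule theI')
qed

lemma dual_basis_linear: "dual_basis x \<Longrightarrow> linear (x i)"
  by (simp add: dual_basis_def)

lemma dual_basis_linear_sum:
  assumes "dual_basis x"
  shows "linear (\<lambda>v. \<Sum>i\<in>T. c i * x i v)"
  using linear_compose_sum[of T "\<lambda>i v. c i * x i v"] assms
    linear_compose_scale_right[of "x _" "c _"]
  by (simp add: dual_basis_linear real_scaleR_def)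

text \<open>The zero form also has all coordinates zero, and coordinates are unique.\<close>

lemma dual_basis_independent:
  assumes "dual_basis x" "(\<lambda>v. \<Sum>i\<in>UNIV. c i * x i v) = (\<lambda>v. 0)"
  shows "c i = 0"
proof -
  have "\<exists>!c. (\<lambda>v. 0) = (\<lambda>v. \<Sum>i\<in>UNIV. c i * x i v)"
    using assms(1) linear_zero unfolding dual_basis_def by blast
  then obtain d where d: "\<And>c. (\<lambda>v. 0) = (\<lambda>v. \<Sum>i\<in>UNIV. c i * x i v) \<Longrightarrow> c = d"
    by (elim ex1E) blast
  have "c = d"
    by (rule d) (rule assms(2)[symmetric])
  moreover have "(\<lambda>i. 0) = d"
    by (rule d) simp
  ultimately show ?thesis
    by (metis (no_types))
qed

lemma lin_poly_linform: "lin_poly x f = linform (\<lambda>i. complex_of_real (dual_coords x f i))"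
  by (simp add: lin_poly_def linform_def)

definition gram :: "('n::finite \<Rightarrow> 'v \<Rightarrow> real) \<Rightarrow> (('v \<Rightarrow> real) \<Rightarrow> ('v \<Rightarrow> real) \<Rightarrow> real) \<Rightarrow> real ^ 'n ^ 'n"
  where "gram x I = (\<chi> i j. I (x i) (x j))"

context
  fixes x :: "'n::{finite,linorder} \<Rightarrow> 'v::real_vector \<Rightarrow> real"
    and I :: "('v \<Rightarrow> real) \<Rightarrow> ('v \<Rightarrow> real) \<Rightarrow> real"
  assumes x: "dual_basis x"
    and I: "dual_inner_product I"
begin

lemma transpose_gram: "Finite_Cartesian_Product.transpose (gram x I) = gram x I"
  using I dual_basis_linear[OF x]
  by (simp add: vec_eq_iff gram_def Finite_Cartesian_Product.transpose_def dual_inner_product_def)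

lemma inner_sum:
  assumes g: "linear g"
  shows "I (\<lambda>v. \<Sum>i\<in>T. c i * x i v) g = (\<Sum>i\<in>T. c i * I (x i) g)"
proof -
  have add: "I (\<lambda>v. f v + h v) g = I f g + I h g" if "linear f" "linear h" for f h
    using I g that by (simp add: dual_inner_product_def)
  have scale: "I (\<lambda>v. b * f v) g = b * I f g" if "linear f" for b f
    using I g that by (simp add: dual_inner_product_def)
  have zero: "I (\<lambda>v. 0) g = 0"
    using scale[OF linear_zero, of 0] by simp
  have lin: "linear (\<lambda>v. c i * x i v)" for i
    using dual_basis_linear_sum[OF x, where T = "{i}" and c = c] by simp
  show ?thesis
  proof (induction T rule: infinite_finite_induct)
    case (insert t T)
    have "I (\<lambda>v. \<Sum>i\<in>insert t T. c i * x i v) g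
        = I (\<lambda>v. c t * x t v + (\<Sum>i\<in>T. c i * x i v)) g"
      using insert.hyps by simp
    also have "\<dots> = I (\<lambda>v. c t * x t v) g + I (\<lambda>v. \<Sum>i\<in>T. c i * x i v) g"
      by (rule add[OF lin dual_basis_linear_sum[OF x]])
    also have "\<dots> = (\<Sum>i\<in>insert t T. c i * I (x i) g)"
      unfolding sum.insert[OF insert.hyps] insert.IH scale[OF dual_basis_linear[OF x]] ..
    finally show ?case .
  qed (simp_all add: zero)
qed

text \<open>The linear form with coordinates \<open>c\<close> is orthogonal to every
  \<open>x i\<close>, hence to itself, and so vanishes by positive definiteness.\<close>

lemma gram_kernel:
  assumes "gram x I *v c = 0"
  shows "c = 0"
proof -
  define f where "f = (\<lambda>v. \<Sum>i\<in>UNIV. c $ i * x i v)"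
  have f: "linear f"
    unfolding f_def by (rule dual_basis_linear_sum[OF x])
  have sym: "I g h = I h g" if "linear g" "linear h" for g h
    using I that by (simp add: dual_inner_product_def)
  have "(\<Sum>j\<in>UNIV. I (x i) (x j) * c $ j) = 0" for i
    using assms by (simp add: vec_eq_iff gram_def matrix_vector_mult_def)
  moreover have "I f (x i) = (\<Sum>j\<in>UNIV. I (x i) (x j) * c $ j)" for i
    unfolding f_def inner_sum[OF dual_basis_linear[OF x]]
    by (intro sum.cong) (simp_all add: sym[of "x i"] dual_basis_linear[OF x])
  ultimately have "I (x i) f = 0" for i
    using sym[OF f dual_basis_linear[OF x]] by simp
  moreover have "I f f = (\<Sum>i\<in>UNIV. c $ i * I (x i) f)"
    unfolding f_def by (rule inner_sum[OF f[unfolded f_def]])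
  ultimately have "I f f = 0"
    by simp
  then have "f = (\<lambda>v. 0)"
    using I f unfolding dual_inner_product_def by (metis less_irrefl)
  then have "c $ i = 0" for i
    unfolding f_def by (rule dual_basis_independent[OF x])
  then show ?thesis
    by (simp add: vec_eq_iff)
qed

lemma gram_inverse:
  obtains R where "gram x I ** R = mat 1" "R ** gram x I = mat 1"
    "Finite_Cartesian_Product.transpose R = R"
proof -
  obtain R where RG: "R ** gram x I = mat 1"
    using gram_kernel matrix_left_invertible_ker[of "gram x I"] by blast
  then have GR: "gram x I ** R = mat 1"
    by (simp add: matrix_left_right_inverse)
  \<comment> \<open>The transpose of \<open>R\<close> is another left inverse, so it equals
    \<open>R\<close>.\<close>
  have "Finite_Cartesian_Product.transpose R ** gram x I = mat 1"
    by (metis GR matrix_transpose_mul transpose_gram transpose_mat)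
  then have "Finite_Cartesian_Product.transpose R = R"
    by (metis GR matrix_mul_assoc matrix_mul_lid matrix_mul_rid)
  with RG GR that show ?thesis by blast
qed

text \<open>\<open>I_form\<close> sums over the first index of the Gram matrix, the matrix product
  over the second; symmetry identifies them.\<close>

lemma I_der_gram: "I_der x I \<omega> = emb_matrix (gram x I) *v \<omega>"
proof -
  have sym: "I (x i) (x j) = I (x j) (x i)" for i j
    using transpose_gram
    by (simp add: vec_eq_iff gram_def Finite_Cartesian_Product.transpose_def)
  show ?thesis
    by (simp add: vec_eq_iff I_der_def I_form_def ext_d_Var axis_def emb_matrix_def gram_def
        matrix_vector_mult_def real_emb_def if_distrib if_distribR sym mult.commute cong: if_cong)
qed

end

section \<open>Equations of the hyperplanes\<close>

context
  fixes x :: "'n::{finite,linorder} \<Rightarrow> 'v::real_vector \<Rightarrow> real"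
    and A :: "'v set set"
    and \<alpha> :: "'v set \<Rightarrow> 'v \<Rightarrow> real"
  assumes x: "dual_basis x"
    and A: "central_arrangement A"
    and \<alpha>: "defining_forms A \<alpha>"
begin

lemma form_linear: "H \<in> A \<Longrightarrow> linear (\<alpha> H)"
  and form_kernel: "H \<in> A \<Longrightarrow> \<alpha> H v = 0 \<longleftrightarrow> v \<in> H"
  using \<alpha> by (auto simp: defining_forms_def)

lemma form_coeff_nonzero:
  assumes H: "H \<in> A"
  obtains j where "dual_coords x (\<alpha> H) j \<noteq> 0"
proof -
  \<comment> \<open>Equality would contradict \<open>dim H + 1 = dim UNIV\<close>.\<close>
  have "H \<noteq> UNIV"
    using A H by (auto simp: central_arrangement_def)
  then obtain v where "\<alpha> H v \<noteq> 0"
    using form_kernel[OF H] by blast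
  then have "(\<Sum>i\<in>UNIV. dual_coords x (\<alpha> H) i * x i v) \<noteq> 0"
    using fun_cong[OF dual_coords_eq[OF x form_linear[OF H]], of v] by simp
  then show ?thesis
    using that by (metis (no_types, lifting) mult_eq_0_iff sum.neutral)
qed

lemma prime_elem_form:
  assumes "H \<in> A"
  shows "prime_elem (lin_poly x (\<alpha> H))"
proof -
  obtain j where "dual_coords x (\<alpha> H) j \<noteq> 0"
    using form_coeff_nonzero[OF assms] .
  then show ?thesis
    unfolding lin_poly_linform by (intro prime_elem_linform[of _ j]) simp
qed

text \<open>Divisibility would make the two forms proportional, so their kernels \<open>H\<close>
  and \<open>K\<close> would coincide.\<close>

lemma form_not_dvd_form:
  assumes H: "H \<in> A" and K: "K \<in> A" and "H \<noteq> K"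
  shows "\<not> lin_poly x (\<alpha> H) dvd lin_poly x (\<alpha> K)"
proof
  assume dvd: "lin_poly x (\<alpha> H) dvd lin_poly x (\<alpha> K)"
  let ?c = "dual_coords x (\<alpha> H)" and ?d = "dual_coords x (\<alpha> K)"
  obtain j where j: "?c j \<noteq> 0"
    using form_coeff_nonzero[OF H] .
  have "complex_of_real (?d i) = complex_of_real (?d j / ?c j * ?c i)" for i
    using linform_dvd_linform[OF _ dvd[unfolded lin_poly_linform], of j i] j by simp
  \<comment> \<open>The complex factor of proportionality is a quotient of real coefficients, so the
    relation descends to the reals.\<close>
  then have d: "?d i = ?d j / ?c j * ?c i" for i
    by (rule of_real_eq_iff[THEN iffD1])
  have eq: "\<alpha> K v = ?d j / ?c j * \<alpha> H v" for v
  proof -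
    have "\<alpha> K v = (\<Sum>i\<in>UNIV. ?d i * x i v)"
      using fun_cong[OF dual_coords_eq[OF x form_linear[OF K]]] .
    also have "\<dots> = (\<Sum>i\<in>UNIV. ?d j / ?c j * (?c i * x i v))"
    proof (rule sum.cong)
      show "?d i * x i v = ?d j / ?c j * (?c i * x i v)" for i
        by (subst d) (rule mult.assoc)
    qed simp
    also have "\<dots> = ?d j / ?c j * (\<Sum>i\<in>UNIV. ?c i * x i v)"
      by (simp only: sum_distrib_left)
    also have "(\<Sum>i\<in>UNIV. ?c i * x i v) = \<alpha> H v"
      using fun_cong[OF dual_coords_eq[OF x form_linear[OF H]], of v] by simp
    finally show ?thesis .
  qed
  have "?d j \<noteq> 0"
  proof
    assume "?d j = 0"
    then have "?d i = 0" for i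
      using d[of i] by simp
    then show False
      using form_coeff_nonzero[OF K] by blast
  qed
  then have "\<alpha> K v = 0 \<longleftrightarrow> \<alpha> H v = 0" for v
    using eq[of v] j by simp
  then show False
    using \<open>H \<noteq> K\<close> form_kernel H K by blast
qed

text \<open>The derivatives of a linear form are constants, and a nonzero constant is a
  unit.\<close>

lemma form_unit_coeff:
  assumes "H \<in> A"
  shows "\<exists>j u. emb u * ext_d (lin_poly x (\<alpha> H)) $ j = 1"
proof -
  obtain j where j: "dual_coords x (\<alpha> H) j \<noteq> 0"
    using form_coeff_nonzero[OF assms] .
  have "emb (Const (1 / complex_of_real (dual_coords x (\<alpha> H) j)))
      * ext_d (lin_poly x (\<alpha> H)) $ j = 1"
    using j by (simp add: ext_d_def lin_poly_linform pdiff_linform flip: emb_mult Const_mult)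
  then show ?thesis by blast
qed

end

section \<open>Identification with the generalized logarithmic modules\<close>

lemma arr_Q_neg:
  fixes A :: "'v::real_vector set set"
  assumes "finite A"
  shows "arr_Q x \<alpha> (neg_part A n) (neg_mult A n) = (\<Prod>H\<in>A. lin_poly x (\<alpha> H) ^ nat (- n H))"
  unfolding arr_Q_def
proof (rule prod.mono_neutral_cong_left[OF assms])
  show "neg_part A n \<subseteq> A"
    unfolding neg_part_def by blast
  \<comment> \<open>Truncation by \<open>nat\<close> makes the factors outside
    \<open>neg_part A n\<close> equal to 1.\<close>
  have nat_0: "nat (- n H) = 0" if "H \<in> A - neg_part A n" for H
  proof -
    have "0 \<le> n H"
      using that unfolding neg_part_def by (metis DiffE linorder_not_less mem_Collect_eq)
    then show ?thesis
      by (rule nat_0_iff[THEN iffD2, OF neg_le_0_iff_le[THEN iffD2]])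
  qed
  show "\<forall>H\<in>A - neg_part A n. lin_poly x (\<alpha> H) ^ nat (- n H) = 1"
  proof
    show "lin_poly x (\<alpha> H) ^ nat (- n H) = 1" if "H \<in> A - neg_part A n" for H
      unfolding nat_0[OF that] by (rule power_0)
  qed
  show "lin_poly x (\<alpha> H) ^ neg_mult A n H = lin_poly x (\<alpha> H) ^ nat (- n H)"
    if "H \<in> neg_part A n" for H
    unfolding neg_mult_def if_P[OF that] ..
qed

theorem theorem1p7:
  fixes x :: "'n::{finite,linorder} \<Rightarrow> 'v::real_vector \<Rightarrow> real"
    and I :: "('v \<Rightarrow> real) \<Rightarrow> ('v \<Rightarrow> real) \<Rightarrow> real"
    and A :: "'v set set"
    and \<alpha> :: "'v set \<Rightarrow> 'v \<Rightarrow> real"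
    and m :: "'v set \<Rightarrow> int"
  assumes "dim (UNIV :: 'v set) = CARD('n)"
    and "dual_basis x"
    and "dual_inner_product I"
    and "central_arrangement A"
    and "defining_forms A \<alpha>"
  shows "dual_modules vec_scale (gen_log_module x I \<alpha> A m)
                      vec_scale (gen_log_module x I \<alpha> A (\<lambda>H. - m H))"
proof -
  note xI = assms(2,3) and arr = assms(2,4,5)
  define G where "G = emb_matrix (gram x I)"
  obtain R where R: "gram x I ** R = mat 1" "R ** gram x I = mat 1"
      "Finite_Cartesian_Product.transpose R = R"
    by (rule gram_inverse[OF xI])
  define B where "B = emb_matrix R"
  interpret prime_family A "\<lambda>H. lin_poly x (\<alpha> H)" G B
  proof
    show "finite A"
      using assms(4) by (simp add: central_arrangement_def)
    show "G ** B = mat 1" "B ** G = mat 1"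
      using R by (simp_all add: G_def B_def emb_matrix_1 flip: emb_matrix_mult)
    show "Finite_Cartesian_Product.transpose G = G" "Finite_Cartesian_Product.transpose B = B"
      by (simp_all add: G_def B_def transpose_emb_matrix transpose_gram[OF xI] R)
    show "G $ i $ j \<in> range emb" "B $ i $ j \<in> range emb" for i j
      by (simp_all add: G_def B_def emb_matrix_range)
  qed (use prime_elem_form[OF arr] form_not_dvd_form[OF arr] form_unit_coeff[OF arr] in blast)+
  \<comment> \<open>Stated for arbitrary \<open>n\<close>, this serves both \<open>m\<close> and its
    negative.\<close>
  have "gen_log_module x I \<alpha> A n = dmod n" for n
  proof (rule set_eqI)
    fix \<delta> :: "'n rat_der"
    define q where "q = den (\<lambda>H. - n H)"
    have q: "emb q \<noteq> 0"
      by (simp add: q_def den_nonzero)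
    have arr_Q: "arr_Q x \<alpha> (neg_part A n) (neg_mult A n) = q"
      using arr_Q_neg[OF fin] by (simp only: q_def den_def)
    have scaled: "(\<exists>\<theta>\<in>T. v = inverse (emb q) *s \<theta>) \<longleftrightarrow> emb q *s v \<in> T" for v :: "'n rat_der" and T
    proof
      assume "\<exists>\<theta>\<in>T. v = inverse (emb q) *s \<theta>"
      then show "emb q *s v \<in> T"
        using q by (auto simp: vector_smult_assoc)
    next
      assume "emb q *s v \<in> T"
      moreover have "v = inverse (emb q) *s (emb q *s v)"
        using q by (simp add: vector_smult_assoc)
      ultimately show "\<exists>\<theta>\<in>T. v = inverse (emb q) *s \<theta>" by blast
    qed
    have clears: "emb q *s v \<in> regular_vecs \<longleftrightarrow> clears q v" for v :: "'n rat_der"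
      by (simp add: regular_vecs_def clears_def)
    have "\<delta> \<in> (\<lambda>\<theta>. inverse (emb q) *s \<theta>) ` log_der x \<alpha> (pos_part A n) (pos_mult A n)
        \<longleftrightarrow> emb q *s \<delta> \<in> log_der x \<alpha> (pos_part A n) (pos_mult A n)"
      using scaled by (auto simp: image_iff)
    also have "\<dots> \<longleftrightarrow> clears q \<delta> \<and> (\<forall>H\<in>A. n H > 0 \<longrightarrow>
        (\<exists>s. emb q * dot \<delta> (grad H) = emb (s * lin_poly x (\<alpha> H) ^ nat (n H))))"
    proof -
      have "der_apply (emb q *s \<delta>) f = emb q * dot \<delta> (ext_d f)" for f
        by (simp add: der_apply_def dot_def ext_d_def sum_distrib_left mult.assoc)
      then show ?thesis
        by (auto simp: log_der_def clears pos_part_def pos_mult_def)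
    qed
    finally have der: "\<delta> \<in> (\<lambda>\<theta>. inverse (emb q) *s \<theta>) ` log_der x \<alpha> (pos_part A n) (pos_mult A n)
        \<longleftrightarrow> clears q \<delta> \<and> (\<forall>H\<in>A. n H > 0 \<longrightarrow>
          (\<exists>s. emb q * dot \<delta> (grad H) = emb (s * lin_poly x (\<alpha> H) ^ nat (n H))))" .
    \<comment> \<open>The map on forms is multiplication by \<open>G\<close>, with inverse
      \<open>B\<close>, so membership in its image is tested on
      \<open>B *v \<delta>\<close>.\<close>
    have "\<delta> \<in> I_der x I ` log_form x \<alpha> (neg_part A n) (neg_mult A n)
        \<longleftrightarrow> B *v \<delta> \<in> log_form x \<alpha> (neg_part A n) (neg_mult A n)"
      unfolding I_der_gram[OF xI] G_def[symmetric]
    proof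
      assume "B *v \<delta> \<in> log_form x \<alpha> (neg_part A n) (neg_mult A n)"
      then have "G *v (B *v \<delta>) \<in> (*v) G ` log_form x \<alpha> (neg_part A n) (neg_mult A n)"
        by (rule imageI)
      then show "\<delta> \<in> (*v) G ` log_form x \<alpha> (neg_part A n) (neg_mult A n)"
        by simp
    qed auto
    also have "\<dots> \<longleftrightarrow> clears q (B *v \<delta>) \<and> (\<forall>H\<in>A. n H < 0 \<longrightarrow>
        form2_regular_along (lin_poly x (\<alpha> H)) (wedge (grad H) (B *v \<delta>)))"
    proof -
      have image: "B *v \<delta> \<in> (\<lambda>\<eta>. inverse (emb q) *s \<eta>) ` regular_vecs \<longleftrightarrow> clears q (B *v \<delta>)"
        unfolding clears[symmetric] scaled[symmetric] by (auto simp: image_iff)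
      have ball: "(\<forall>H\<in>neg_part A n. P H) \<longleftrightarrow> (\<forall>H\<in>A. n H < 0 \<longrightarrow> P H)" for P
        unfolding neg_part_def by blast
      show ?thesis
        unfolding log_form_def arr_Q mem_Collect_eq image ball ..
    qed
    finally have form: "\<delta> \<in> I_der x I ` log_form x \<alpha> (neg_part A n) (neg_mult A n)
        \<longleftrightarrow> clears q (B *v \<delta>) \<and> (\<forall>H\<in>A. n H < 0 \<longrightarrow>
          form2_regular_along (lin_poly x (\<alpha> H)) (wedge (grad H) (B *v \<delta>)))" .
    \<comment> \<open>The denominator condition on the form follows from that on the derivation, as
      \<open>B\<close> has polynomial entries.\<close>
    have "clears q \<delta> \<Longrightarrow> clears q (B *v \<delta>)"
      by (intro clears_matrix_mult B_range)
    then show "\<delta> \<in> gen_log_module x I \<alpha> A n \<longleftrightarrow> \<delta> \<in> dmod n"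
      unfolding gen_log_module_def arr_Q Int_iff der form
      by (auto simp: dmod_def q_def)
  qed
  then show ?thesis
    using dual_modules_dmod by simp
qed

end
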